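(* There is an absolute constant $C>0$ such that the following holds. Let $\mathcal{F}$ be a set of densities, let $\mathcal{H}$ be the ratio class of $\mathcal{F}$, and suppose the VC dimension of $\mathcal{H}$ is $d\ge 1$. Let $n\ge2$, $\delta\in(0,1)$. Given $n$ i.i.d. samples from a distribution $f$ without atoms ($f$ need not be in $\mathcal{F}$), with empirical distribution $f_n$, let $$\hat f_n\in\operatorname*{arg\,min}_{f_\theta\in\mathcal{F}} \mathrm{d}_{\mathcal{H}}(f_\theta,f_n)$$ be the minimum-distance estimator with respect to $\mathcal{H}$. Then with probability at least $1-\delta$, $$\mathrm{H}^2(f,\hat f_n)\le C\left(\inf_{f_\theta\in\mathcal{F}}\mathrm{H}^2(f,f_\theta)\log\!\left(\frac{2}{\mathrm{H}^2(f,f_\theta)}\right)+\frac{\left(d\log(n)+\log\frac2\delta\right)\log(n)}{n}\right).$$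
   Context: $\log$ is base 2. The squared Hellinger distance is $\mathrm{H}^2(p,q)=\frac12\int(\sqrt{p(x)}-\sqrt{q(x)})^2$ (densities with respect to a common dominating measure). The ratio class of $\mathcal{F}$ is the concept class $$\mathcal{H}=\left\{\left\{x:\frac{f_\theta(x)}{f_{\theta'}(x)}\ge\tau\right\}: f_\theta,f_{\theta'}\in\mathcal{F},\ \tau\in\mathbb{R}\right\},$$ with ratios taking values in $[0,\infty]$ (a positive number divided by $0$ is $+\infty$). The associated distance between two distributions $p,q$ is $$\mathrm{d}_{\mathcal{H}}(p,q)=\sup_{H\in\mathcal{H}}\frac12\left(\sqrt{\Pr_p[x\in H]}-\sqrt{\Pr_q[x\in H]}\right)^2.$$ The minimizer defining $\hat f_n$ is assumed to exist (any minimizer is allowed). The expression $x\log(c/x)$ is read as $0$ at $x=0$.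
   Formalization: Adds that, for i.i.d. samples from f, the event that some set of the ratio class picks out exactly a given subset of sample points is measurable up to null sets (without it the claim fails for a pathological well-ordered class); C is stated for each underlying set of sample points. *)

theory Defs
  imports "HOL-Probability.Probability"
begin

definition prob_density :: "'a measure \<Rightarrow> ('a \<Rightarrow> real) \<Rightarrow> bool" where
  "prob_density \<mu> f \<longleftrightarrow>
     f \<in> borel_measurable \<mu> \<and> (\<forall>x\<in>space \<mu>. 0 \<le> f x) \<and> (\<integral>\<^sup>+x. ennreal (f x) \<partial>\<mu>) = 1"

definition distribution_of :: "'a measure \<Rightarrow> ('a \<Rightarrow> real) \<Rightarrow> 'a measure" where
  "distribution_of \<mu> f = density \<mu> (\<lambda>x. ennreal (f x))"

definition plus_measure :: "'a measure \<Rightarrow> 'a measure \<Rightarrow> 'a measure" where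
  "plus_measure p q = measure_of (space p) (sets p) (\<lambda>A. emeasure p A + emeasure q A)"

lemma sets_plus_measure [simp]: "sets (plus_measure p q) = sets p"
  by (simp add: plus_measure_def)

lemma space_plus_measure [simp]: "space (plus_measure p q) = space p"
  by (simp add: plus_measure_def)

lemma emeasure_plus_measure:
  assumes "sets p = sets q" "A \<in> sets p"
  shows "emeasure (plus_measure p q) A = emeasure p A + emeasure q A"
proof (rule emeasure_measure_of [OF plus_measure_def])
  show "sets p \<subseteq> Pow (space p)"
    by (rule sets.space_closed)
  show "positive (sets (plus_measure p q)) (\<lambda>A. emeasure p A + emeasure q A)"
    by (simp add: positive_def)
  show "countably_additive (sets (plus_measure p q)) (\<lambda>A. emeasure p A + emeasure q A)"
  proof (rule countably_additiveI)
    fix B :: "nat \<Rightarrow> 'a set"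
    assume "range B \<subseteq> sets (plus_measure p q)" and disj: "disjoint_family B"
    then have p: "range B \<subseteq> sets p" and q: "range B \<subseteq> sets q"
      using assms(1) by simp_all
    show "(\<Sum>i. emeasure p (B i) + emeasure q (B i))
            = emeasure p (\<Union>i. B i) + emeasure q (\<Union>i. B i)"
      using suminf_emeasure[OF p disj] suminf_emeasure[OF q disj]
      by (simp add: suminf_add[symmetric] summableI)
  qed
  show "A \<in> sets (plus_measure p q)"
    using assms(2) by simp
qed

text \<open>Densities are taken with respect to the common dominating measure \<open>p + q\<close>; the lemma
  below shows that any other common dominating measure gives the same value.\<close>

definition hellinger_sq :: "'a measure \<Rightarrow> 'a measure \<Rightarrow> real" where
  "hellinger_sq p q =
     1 / 2 * (\<integral>x. (sqrt (enn2real (RN_deriv (plus_measure p q) p x))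
                   - sqrt (enn2real (RN_deriv (plus_measure p q) q x)))\<^sup>2 \<partial>(plus_measure p q))"

lemma hellinger_density:
  assumes f: "prob_density \<nu> f" and g: "prob_density \<nu> g"
  shows "hellinger_sq (distribution_of \<nu> f) (distribution_of \<nu> g) =
    1 / 2 * (\<integral>x. (sqrt (f x) - sqrt (g x))\<^sup>2 \<partial>\<nu>)"
proof -
  let ?p = "distribution_of \<nu> f" and ?q = "distribution_of \<nu> g"
  have [measurable]: "f \<in> borel_measurable \<nu>" "g \<in> borel_measurable \<nu>"
    and f0: "\<And>x. x\<in>space \<nu> \<Longrightarrow> 0 \<le> f x" and g0: "\<And>x. x\<in>space \<nu> \<Longrightarrow> 0 \<le> g x"
    and f1: "(\<integral>\<^sup>+x. ennreal (f x) \<partial>\<nu>) = 1" and g1: "(\<integral>\<^sup>+x. ennreal (g x) \<partial>\<nu>) = 1"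
    using f g by (auto simp: prob_density_def)
  define h where "h = (\<lambda>x. f x + g x)"
  have [measurable]: "h \<in> borel_measurable \<nu>" by (simp add: h_def)
  have h0: "\<And>x. x\<in>space \<nu> \<Longrightarrow> 0 \<le> h x" using f0 g0 by (simp add: h_def)
  have S: "plus_measure ?p ?q = density \<nu> (\<lambda>x. ennreal (h x))"
  proof (rule measure_eqI)
    fix A assume "A \<in> sets (plus_measure ?p ?q)"
    then have A[measurable]: "A \<in> sets \<nu>" by (simp add: distribution_of_def)
    have "emeasure (plus_measure ?p ?q) A = emeasure ?p A + emeasure ?q A"
      by (rule emeasure_plus_measure) (auto simp: distribution_of_def)
    also have "\<dots> = (\<integral>\<^sup>+x. ennreal (f x) * indicator A x + ennreal (g x) * indicator A x \<partial>\<nu>)"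
      by (simp add: distribution_of_def emeasure_density nn_integral_add)
    also have "\<dots> = (\<integral>\<^sup>+x. ennreal (h x) * indicator A x \<partial>\<nu>)"
      by (rule nn_integral_cong) (auto simp: h_def f0 g0 distrib_right split: split_indicator)
    finally show "emeasure (plus_measure ?p ?q) A = emeasure (density \<nu> (\<lambda>x. ennreal (h x))) A"
      by (simp add: emeasure_density)
  qed (simp add: distribution_of_def)
  let ?s = "density \<nu> (\<lambda>x. ennreal (h x))"
  have fin: "emeasure ?s (space \<nu>) = 2"
  proof -
    have "emeasure ?s (space \<nu>) = (\<integral>\<^sup>+x. ennreal (f x) + ennreal (g x) \<partial>\<nu>)"
      by (auto simp: emeasure_density h_def f0 g0 intro!: nn_integral_cong)
    then show ?thesis by (simp add: nn_integral_add f1 g1)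
  qed
  interpret s: finite_measure ?s by (rule finite_measureI) (simp add: fin)
  have RN: "AE x in ?s. RN_deriv ?s (distribution_of \<nu> k) x = ennreal (k x / h x)"
    if [measurable]: "k \<in> borel_measurable \<nu>" and k: "\<And>x. x\<in>space \<nu> \<Longrightarrow> 0 \<le> k x \<and> k x \<le> h x" for k
  proof -
    have "density ?s (\<lambda>x. ennreal (k x / h x)) = distribution_of \<nu> k"
      unfolding distribution_of_def
      apply (subst density_density_eq, simp, simp)
      apply (rule density_cong, simp, simp)
      apply (rule AE_I2)
      subgoal for x using k[of x] h0[of x] by (cases "h x = 0") (auto simp: ennreal_mult[symmetric])
      done
    then show ?thesis
      using s.RN_deriv_unique[of "\<lambda>x. ennreal (k x / h x)" "distribution_of \<nu> k"] by auto
  qed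
  have "(\<integral>x. (sqrt (enn2real (RN_deriv ?s ?p x)) - sqrt (enn2real (RN_deriv ?s ?q x)))\<^sup>2 \<partial>?s)
     = (\<integral>x. (sqrt (f x / h x) - sqrt (g x / h x))\<^sup>2 \<partial>?s)"
  proof (rule integral_cong_AE)
    show "AE x in ?s. (sqrt (enn2real (RN_deriv ?s ?p x)) - sqrt (enn2real (RN_deriv ?s ?q x)))\<^sup>2 = (sqrt (f x / h x) - sqrt (g x / h x))\<^sup>2"
      using RN[of f] RN[of g] AE_space[of ?s] f0 g0 h0
      by (auto simp: h_def)
  next
    have [simp]: "borel_measurable ?s = borel_measurable \<nu>" by (rule measurable_cong_sets) auto
    show "(\<lambda>x. (sqrt (enn2real (RN_deriv ?s ?p x)) - sqrt (enn2real (RN_deriv ?s ?q x)))\<^sup>2) \<in> borel_measurable ?s"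
      using borel_measurable_RN_deriv[of ?s ?p] borel_measurable_RN_deriv[of ?s ?q] by measurable
    show "(\<lambda>x. (sqrt (f x / h x) - sqrt (g x / h x))\<^sup>2) \<in> borel_measurable ?s" by simp
  qed
  also have "\<dots> = (\<integral>x. h x * (sqrt (f x / h x) - sqrt (g x / h x))\<^sup>2 \<partial>\<nu>)"
    by (subst integral_density) (auto simp: h0)
  also have "\<dots> = (\<integral>x. (sqrt (f x) - sqrt (g x))\<^sup>2 \<partial>\<nu>)"
  proof (rule Bochner_Integration.integral_cong[OF refl])
    fix x assume x: "x \<in> space \<nu>"
    show "h x * (sqrt (f x / h x) - sqrt (g x / h x))\<^sup>2 = (sqrt (f x) - sqrt (g x))\<^sup>2"
    proof (cases "h x = 0")
      case True then have "f x = 0" "g x = 0" using f0[OF x] g0[OF x] by (auto simp: h_def)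
      then show ?thesis using True by simp
    next
      case False then have "0 < h x" using h0[OF x] by simp
      then show ?thesis by (simp add: real_sqrt_divide diff_divide_distrib[symmetric] power_divide)
    qed
  qed
  finally show ?thesis unfolding hellinger_sq_def S by simp
qed
text \<open>The quotient is taken in \<open>[0, \<infinity>]\<close>: a positive number divided by 0 is \<open>\<infinity>\<close>, and the
  library convention \<open>0 / 0 = 0\<close> applies where both densities vanish. For negative \<open>\<tau>\<close>,
  \<open>ennreal \<tau> = 0\<close> and the condition holds everywhere, as it should.\<close>

definition ratio_class :: "'a measure \<Rightarrow> ('a \<Rightarrow> real) set \<Rightarrow> 'a set set" where
  "ratio_class \<mu> F =
     {{x \<in> space \<mu>. ennreal (f x) / ennreal (g x) \<ge> ennreal \<tau>} | f g (\<tau>::real). f \<in> F \<and> g \<in> F}"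

definition class_dist :: "'a set set \<Rightarrow> 'a measure \<Rightarrow> 'a measure \<Rightarrow> real" where
  "class_dist \<H> p q = (SUP H\<in>\<H>. 1 / 2 * (sqrt (measure p H) - sqrt (measure q H))\<^sup>2)"

definition shatters :: "'a set set \<Rightarrow> 'a set \<Rightarrow> bool" where
  "shatters \<H> S \<longleftrightarrow> (\<forall>T\<subseteq>S. \<exists>H\<in>\<H>. H \<inter> S = T)"

definition vc_dim :: "'a set set \<Rightarrow> enat" where
  "vc_dim \<H> = (SUP S\<in>{S. finite S \<and> shatters \<H> S}. enat (card S))"

text \<open>No point masses; for Borel probability measures on a Polish space this coincides with the absence
  of measure-theoretic atoms.\<close>

definition no_atoms :: "'a measure \<Rightarrow> bool" where
  "no_atoms P \<longleftrightarrow> (\<forall>x\<in>space P. emeasure P {x} = 0)"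

definition iid_sample :: "nat \<Rightarrow> 'a measure \<Rightarrow> (nat \<Rightarrow> 'a) measure" where
  "iid_sample n P = PiM {..<n} (\<lambda>_. P)"

definition empirical :: "nat \<Rightarrow> 'a measure \<Rightarrow> (nat \<Rightarrow> 'a) \<Rightarrow> 'a measure" where
  "empirical n M \<omega> = distr (uniform_count_measure {..<n}) M \<omega>"

text \<open>Measurability condition implicit in every uniform law of large numbers over a possibly
  uncountable class: the event that some member of the class picks out exactly the sample points
  with index in \<open>I\<close> is measurable, up to null sets. Finite VC dimension alone does not imply
  uniform convergence: if the proper initial segments of a well-order are all null for an atomless
  distribution, they form a class of VC dimension 1 for which it fails. Countable classes of
  measurable sets satisfy the condition.\<close>

definition sample_measurable :: "'a measure \<Rightarrow> 'a set set \<Rightarrow> bool" where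
  "sample_measurable P \<H> \<longleftrightarrow>
     (\<forall>m. \<forall>I\<subseteq>{..<m}.
        {\<omega> \<in> space (iid_sample m P). \<exists>H\<in>\<H>. \<forall>i<m. \<omega> i \<in> H \<longleftrightarrow> i \<in> I}
          \<in> sets (completion (iid_sample m P)))"

end

(*
Idea. Ghost-sample symmetrization with random swaps, Sauer-Shelah and Hoeffding's bound for
Rademacher sums controls the square-root deviations of P(H) and P_n(H), uniformly over H in the
ratio class, by eps = O((d log n + log (2/delta)) / n) after squaring. Working with square roots
makes the swap bound scale free: |sqrt a - sqrt b| <= |a - b| / sqrt (a + b), and both a + b and the
variance proxy of a - b are invariant under swaps. Since the ratio-class distance is dominated by
the squared Hellinger distance, the estimator is within O(h + eps) of any competitor g in
ratio-class distance, where h = H^2(f, g). A dyadic decomposition of the likelihood ratio of two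
members of F turns a ratio-class distance D into H^2 = O(D K + 4^-K) for every K, and 2^K of order
min(1/h, n) gives the theorem.
*)
theory Submission
  imports Defs
begin

subsection \<open>The Sauer--Shelah bound\<close>

text \<open>Additive uniform deviations of size \<open>sqrt \<epsilon>\<close> would leave a squared
  root gap of order \<open>sqrt \<epsilon>\<close> for sets of small probability; deviations
  measured between square roots leave \<open>\<epsilon>\<close>, which is what gives the rate 1 / n.
  Two obstacles shape the argument. The class may be uncountable, so the bad event on the doubled
  sample is measurable only in the completion; the good event is therefore defined through the
  measure of the sections of a measurable enlargement, and no member of the class is ever chosen
  measurably. Moreover the class knows only ratios of members of \<open>F\<close>, so passing from
  class distance back to Hellinger distance is possible for the estimator against a competitor in
  \<open>F\<close>, but not for the estimator against the true distribution. The true distribution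
  enters only through triangle inequalities, each of which costs a factor 2 because the distances
  are squared.\<close>

lemma shattersI: "(\<And>T. T \<subseteq> S \<Longrightarrow> \<exists>H\<in>\<H>. H \<inter> S = T) \<Longrightarrow> shatters \<H> S"
  by (simp add: shatters_def)

lemma shattersE:
  assumes "shatters \<H> S" "T \<subseteq> S"
  obtains H where "H \<in> \<H>" "H \<inter> S = T"
  using assms unfolding shatters_def by metis

text \<open>Pajor's strengthening: counting shattered sets, instead of bounding their size, makes
  the induction close. Deleting \<open>x\<close> leaves the traces \<open>T0\<close> and
  \<open>R\<close>. A set shattered by their union is shattered by the whole family, and one
  shattered by their intersection stays so after adding \<open>x\<close>. The two kinds are
  disjoint, since only the second contains \<open>x\<close>.\<close>

lemma card_le_card_shattered:
  assumes "finite S" "\<T> \<subseteq> Pow S"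
  shows "card \<T> \<le> card {U. U \<subseteq> S \<and> shatters \<T> U}"
  using assms
proof (induction S arbitrary: \<T> rule: finite_induct)
  case empty
  then consider "\<T> = {}" | "\<T> = {{}}" by (auto simp: subset_singleton_iff)
  then show ?case
  proof cases
    case 2
    then have "{U. U \<subseteq> {} \<and> shatters \<T> U} = {{}}" by (auto simp: shatters_def)
    then show ?thesis using 2 by simp
  qed simp
next
  case (insert x S)
  define T0 where "T0 = {T \<in> \<T>. x \<notin> T}"
  define T1 where "T1 = {T \<in> \<T>. x \<in> T}"
  define R where "R = (\<lambda>T. T - {x}) ` T1"
  have fin: "finite \<T>" using insert finite_subset[of \<T> "Pow (insert x S)"] by simp
  then have fin': "finite T0" "finite T1" "finite R" by (auto simp: T0_def T1_def R_def)
  have inj: "inj_on (\<lambda>T. T - {x}) T1" by (auto simp: inj_on_def T1_def)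
  have "card \<T> = card (T0 \<union> T1)" by (rule arg_cong[where f = card]) (auto simp: T0_def T1_def)
  also have "\<dots> = card T0 + card T1"
    using fin' by (intro card_Un_disjoint) (auto simp: T0_def T1_def)
  also have "card T1 = card R" unfolding R_def using inj by (simp add: card_image)
  also have "card T0 + card R = card (T0 \<union> R) + card (T0 \<inter> R)"
    by (rule card_Un_Int[OF fin'(1,3)])
  also have "\<dots> \<le> card {U. U \<subseteq> S \<and> shatters (T0 \<union> R) U} + card {U. U \<subseteq> S \<and> shatters (T0 \<inter> R) U}"
    using insert.prems by (intro add_mono insert.IH) (auto simp: T0_def R_def T1_def)
  also have "card {U. U \<subseteq> S \<and> shatters (T0 \<inter> R) U}
      = card (insert x ` {U. U \<subseteq> S \<and> shatters (T0 \<inter> R) U})"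
    using insert.hyps by (intro card_image[symmetric]) (auto simp: inj_on_def)
  also have "card {U. U \<subseteq> S \<and> shatters (T0 \<union> R) U} + \<dots>
     = card ({U. U \<subseteq> S \<and> shatters (T0 \<union> R) U} \<union> insert x ` {U. U \<subseteq> S \<and> shatters (T0 \<inter> R) U})"
    using insert.hyps by (intro card_Un_disjoint[symmetric]) auto
  also have "\<dots> \<le> card {U. U \<subseteq> insert x S \<and> shatters \<T> U}"
  proof (rule card_mono)
    show "finite {U. U \<subseteq> insert x S \<and> shatters \<T> U}"
      by (rule finite_subset[of _ "Pow (insert x S)"]) (use insert.hyps in auto)
    have 1: "shatters \<T> U" if sub: "U \<subseteq> S" and sh: "shatters (T0 \<union> R) U" for U
    proof (rule shattersI)
      fix T assume "T \<subseteq> U"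
      then obtain V where V: "V \<in> T0 \<union> R" "V \<inter> U = T" using shattersE[OF sh] by metis
      have "x \<notin> U" using that insert.hyps by auto
      then show "\<exists>H\<in>\<T>. H \<inter> U = T" using V by (auto simp: T0_def R_def T1_def)
    qed
    have 2: "shatters \<T> (insert x U)" if sub: "U \<subseteq> S" and sh: "shatters (T0 \<inter> R) U" for U
    proof (rule shattersI)
      fix T assume T: "T \<subseteq> insert x U"
      then have "T - {x} \<subseteq> U" by auto
      then obtain V where V: "V \<in> T0" "V \<in> R" "V \<inter> U = T - {x}"
        using shattersE[OF sh] by (metis IntE)
      have xU: "x \<notin> U" using that insert.hyps by auto
      have "x \<notin> V" "V \<in> \<T>" using V by (auto simp: T0_def)
      obtain W where W: "W \<in> \<T>" "x \<in> W" "V = W - {x}" using V by (auto simp: R_def T1_def)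
      show "\<exists>H\<in>\<T>. H \<inter> insert x U = T"
      proof (cases "x \<in> T")
        case True
        then have "W \<inter> insert x U = T" using W V(3) xU T by auto
        then show ?thesis using W by blast
      next
        case False
        then have "V \<inter> insert x U = T" using V \<open>x \<notin> V\<close> by auto
        then show ?thesis using \<open>V \<in> \<T>\<close> by blast
      qed
    qed
    show "{U. U \<subseteq> S \<and> shatters (T0 \<union> R) U} \<union> insert x ` {U. U \<subseteq> S \<and> shatters (T0 \<inter> R) U}
        \<subseteq> {U. U \<subseteq> insert x S \<and> shatters \<T> U}"
      using 1 2 by auto
  qed
  finally show ?case by simp
qed

text \<open>This form of the bound needs no case distinction between \<open>card S\<close> and
  \<open>d\<close>: after \<open>m choose k \<le> m ^ k\<close> and insertion of the factor
  \<open>d choose k\<close>, which is at least 1, it is the binomial theorem.\<close>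

lemma card_small_subsets_le:
  assumes "finite S"
  shows "card {U. U \<subseteq> S \<and> card U \<le> d} \<le> (card S + 1) ^ d"
proof -
  let ?m = "card S"
  have "{U. U \<subseteq> S \<and> card U \<le> d} = (\<Union>k\<in>{..d}. {U. U \<subseteq> S \<and> card U = k})" by auto
  then have "card {U. U \<subseteq> S \<and> card U \<le> d} \<le> (\<Sum>k\<le>d. card {U. U \<subseteq> S \<and> card U = k})"
    using card_UN_le[of "{..d}"] by simp
  also have "\<dots> = (\<Sum>k\<le>d. ?m choose k)"
    using n_subsets[OF assms] by simp
  also have "\<dots> \<le> (\<Sum>k\<le>d. (d choose k) * ?m ^ k)"
  proof (rule sum_mono)
    fix k assume "k \<in> {..d}"
    then have "1 \<le> d choose k" by (simp add: Suc_leI zero_less_binomial)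
    moreover have "?m choose k \<le> ?m ^ k"
      by (cases "k \<le> ?m") (auto simp: binomial_le_pow binomial_eq_0)
    ultimately show "?m choose k \<le> (d choose k) * ?m ^ k"
      by (metis mult_le_mono mult_1)
  qed
  also have "\<dots> = (?m + 1) ^ d" using binomial_ring[of ?m 1 d] by simp
  finally show ?thesis .
qed

lemma sauer_shelah:
  assumes vc: "vc_dim \<H> = enat d" and S: "finite S"
  shows "card ((\<lambda>H. H \<inter> S) ` \<H>) \<le> (card S + 1) ^ d"
proof -
  let ?T = "(\<lambda>H. H \<inter> S) ` \<H>"
  have small: "card U \<le> d" if sub: "U \<subseteq> S" and sh: "shatters ?T U" for U
  proof -
    have "shatters \<H> U"
    proof (rule shattersI)
      fix V assume "V \<subseteq> U"
      from shattersE[OF sh this] obtain W where "W \<in> ?T" "W \<inter> U = V" .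
      then obtain H where "H \<in> \<H>" "H \<inter> S \<inter> U = V" by auto
      moreover from this have "H \<inter> U = V" using that by auto
      ultimately show "\<exists>H\<in>\<H>. H \<inter> U = V" by blast
    qed
    moreover have "finite U" using that S finite_subset by blast
    ultimately have "enat (card U) \<le> vc_dim \<H>"
      unfolding vc_dim_def by (intro SUP_upper) auto
    then show ?thesis using vc by simp
  qed
  have "card ?T \<le> card {U. U \<subseteq> S \<and> shatters ?T U}"
    using S by (intro card_le_card_shattered) auto
  also have "\<dots> \<le> card {U. U \<subseteq> S \<and> card U \<le> d}"
    using S small by (intro card_mono[OF finite_subset[of _ "Pow S"]]) auto
  also have "\<dots> \<le> (card S + 1) ^ d" by (rule card_small_subsets_le[OF S])
  finally show ?thesis .
qed

text \<open>Patterns are sets of indices rather than of points, because sample points may coincide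
  while swaps act on positions. A pattern is still determined by the trace on the finite set of
  sampled points.\<close>

lemma card_patterns_le:
  fixes x :: "'i \<Rightarrow> 'a"
  assumes vc: "vc_dim \<H> = enat d" and J: "finite J"
  shows "card ((\<lambda>H. {i \<in> J. x i \<in> H}) ` \<H>) \<le> (card J + 1) ^ d"
    and "finite ((\<lambda>H. {i \<in> J. x i \<in> H}) ` \<H>)"
proof -
  have fin: "finite ((\<lambda>H. H \<inter> x ` J) ` \<H>)"
    by (rule finite_subset[of _ "Pow (x ` J)"]) (use J in auto)
  have "(\<lambda>H. {i \<in> J. x i \<in> H}) ` \<H> = (\<lambda>T. {i \<in> J. x i \<in> T}) ` (\<lambda>H. H \<inter> x ` J) ` \<H>"
    unfolding image_image by (intro image_cong) auto
  then have "card ((\<lambda>H. {i \<in> J. x i \<in> H}) ` \<H>) \<le> card ((\<lambda>H. H \<inter> x ` J) ` \<H>)"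
    using card_image_le[OF fin] by simp
  also have "\<dots> \<le> (card (x ` J) + 1) ^ d" using J by (intro sauer_shelah[OF vc]) auto
  also have "\<dots> \<le> (card J + 1) ^ d" using card_image_le[OF J] by (intro power_mono) auto
  finally show "card ((\<lambda>H. {i \<in> J. x i \<in> H}) ` \<H>) \<le> (card J + 1) ^ d" .
  show "finite ((\<lambda>H. {i \<in> J. x i \<in> H}) ` \<H>)"
    by (rule finite_subset[of _ "Pow J"]) (use J in auto)
qed

subsection \<open>Random swaps\<close>

text \<open>\<open>cosh\<close> is the moment generating function of a fair sign. Factoring
  \<open>exp (- y)\<close> out of \<open>cosh y\<close> leaves the function bounded in Hoeffding's
  lemma, with parameter 1/2 at the argument \<open>2 * y\<close>; evenness covers negative
  arguments.\<close>

lemma cosh_le_exp_half_sq: "cosh (x::real) \<le> exp (x\<^sup>2 / 2)"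
proof -
  have "ln (cosh y) \<le> y\<^sup>2 / 2" if "0 \<le> y" for y :: real
  proof -
    have "cosh y = (exp (- y) + exp (- y) * exp (2 * y)) / 2"
      by (simp add: cosh_def flip: exp_add)
    also have "\<dots> = exp (- y) * (1 + 1/2 * (exp (2 * y) - 1))"
    proof -
      have "(u + u * v) / 2 = u * (1 + 1/2 * (v - 1))" for u v :: real by (simp add: field_simps)
      then show ?thesis .
    qed
    finally have "cosh y = \<dots>" .
    moreover have "0 < 1 + 1/2 * (exp (2 * y) - 1)"
    proof -
      have "0 < 1 + 1/2 * (v - 1)" if "0 < v" for v :: real using that by (simp add: field_simps)
      then show ?thesis by simp
    qed
    ultimately have "ln (cosh y) = - y + ln (1 + 1/2 * (exp (2 * y) - 1))"
      by (simp add: ln_mult)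
    then show ?thesis using Hoeffdings_lemma_aux[of "2 * y" "1/2"] that by (simp add: power2_eq_square)
  qed
  from this[of "\<bar>x\<bar>"] have "ln (cosh x) \<le> x\<^sup>2 / 2" by simp
  then have "exp (ln (cosh x)) \<le> exp (x\<^sup>2 / 2)" by (subst exp_le_cancel_iff)
  then show ?thesis by simp
qed

text \<open>Chernoff's method in counting form: \<open>J\<close> is the set of flipped signs, and
  expectations over fair signs become sums over \<open>Pow A\<close>. Independence of the signs is
  the expansion of a product of two-term sums over subsets, \<open>prod_add\<close>.\<close>

lemma rademacher_upper_tail:
  fixes c :: "'i \<Rightarrow> real"
  assumes A: "finite A" and m: "(\<Sum>i\<in>A. (c i)\<^sup>2) = m" "0 < m" and s: "0 \<le> s"
  shows "card {J \<in> Pow A. s \<le> (\<Sum>i\<in>A. if i \<in> J then - c i else c i)}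
           \<le> 2 ^ card A * exp (- s\<^sup>2 / (2 * m))"
proof -
  \<comment> \<open>This minimizes the final exponent \<open>l\<^sup>2 * m / 2 - l * s\<close> over
    \<open>l\<close>.\<close>
  define l where "l = s / m"
  let ?S = "\<lambda>J. \<Sum>i\<in>A. if i \<in> J then - c i else c i"
  let ?B = "{J \<in> Pow A. s \<le> ?S J}"
  have "real (card ?B) * exp (l * s) = (\<Sum>J\<in>?B. exp (l * s))" by simp
  also have "\<dots> \<le> (\<Sum>J\<in>?B. exp (l * ?S J))"
    using s m by (intro sum_mono) (auto simp: l_def intro!: divide_right_mono mult_left_mono)
  also have "\<dots> \<le> (\<Sum>J\<in>Pow A. exp (l * ?S J))" using A by (intro sum_mono2) auto
  also have "\<dots> = (\<Sum>J\<in>Pow A. (\<Prod>i\<in>J. exp (- (l * c i))) * (\<Prod>i\<in>A - J. exp (l * c i)))"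
  proof (rule sum.cong[OF refl])
    fix J assume J: "J \<in> Pow A"
    have "exp (l * ?S J) = (\<Prod>i\<in>A. if i \<in> J then exp (- (l * c i)) else exp (l * c i))"
      using A by (auto simp: exp_sum sum_distrib_left intro!: prod.cong)
    also have "\<dots> = (\<Prod>i\<in>J. exp (- (l * c i))) * (\<Prod>i\<in>A - J. exp (l * c i))"
      using J A by (subst prod.If_cases) (auto simp: Int_absorb1 Diff_eq Int_commute)
    finally show "exp (l * ?S J) = \<dots>" .
  qed
  also have "\<dots> = (\<Prod>i\<in>A. exp (- (l * c i)) + exp (l * c i))"
    by (rule prod_add[OF A, symmetric])
  also have "\<dots> \<le> (\<Prod>i\<in>A. 2 * exp ((l * c i)\<^sup>2 / 2))"
  proof (rule prod_mono, intro conjI)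
    fix i
    show "0 \<le> exp (- (l * c i)) + exp (l * c i)" by (simp add: add_nonneg_nonneg)
    show "exp (- (l * c i)) + exp (l * c i) \<le> 2 * exp ((l * c i)\<^sup>2 / 2)"
      using cosh_le_exp_half_sq[of "l * c i"] by (simp add: cosh_def)
  qed
  also have "\<dots> = 2 ^ card A * exp (\<Sum>i\<in>A. (l * c i)\<^sup>2 / 2)"
    using A by (simp add: prod.distrib exp_sum)
  also have "(\<Sum>i\<in>A. (l * c i)\<^sup>2 / 2) = l\<^sup>2 * m / 2"
    by (simp add: m(1)[symmetric] power_mult_distrib sum_distrib_left sum_divide_distrib)
  finally have "real (card ?B) \<le> 2 ^ card A * exp (l\<^sup>2 * m / 2) / exp (l * s)"
    by (simp add: pos_le_divide_eq)
  also have "\<dots> = 2 ^ card A * exp (l\<^sup>2 * m / 2 - l * s)" by (simp add: exp_diff)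
  also have "l\<^sup>2 * m / 2 - l * s = - s\<^sup>2 / (2 * m)"
    using m by (simp add: l_def field_simps power2_eq_square)
  finally show ?thesis .
qed

lemma rademacher_tail:
  fixes c :: "'i \<Rightarrow> real"
  assumes A: "finite A" and m: "(\<Sum>i\<in>A. (c i)\<^sup>2) = m" "0 < m" and s: "0 \<le> s"
  shows "card {J \<in> Pow A. s \<le> \<bar>\<Sum>i\<in>A. if i \<in> J then - c i else c i\<bar>}
           \<le> 2 * 2 ^ card A * exp (- s\<^sup>2 / (2 * m))"
proof -
  let ?B = "\<lambda>c. {J \<in> Pow A. s \<le> (\<Sum>i\<in>A. if i \<in> J then - c i else c i)}"
  have neg: "(\<Sum>i\<in>A. if i \<in> J then - (- c i) else - c i) = - (\<Sum>i\<in>A. if i \<in> J then - c i else c i)" for J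
    unfolding sum_negf[symmetric] by (intro sum.cong) auto
  have "{J \<in> Pow A. s \<le> \<bar>\<Sum>i\<in>A. if i \<in> J then - c i else c i\<bar>} \<subseteq> ?B c \<union> ?B (\<lambda>i. - c i)"
    by (auto simp: neg)
  then have "card {J \<in> Pow A. s \<le> \<bar>\<Sum>i\<in>A. if i \<in> J then - c i else c i\<bar>}
      \<le> card (?B c) + card (?B (\<lambda>i. - c i))"
    using A by (intro order_trans[OF card_mono card_Un_le]) auto
  also have "real \<dots> \<le> 2 ^ card A * exp (- s\<^sup>2 / (2 * m)) + 2 ^ card A * exp (- s\<^sup>2 / (2 * m))"
    unfolding of_nat_add using m
    by (intro add_mono rademacher_upper_tail A s) auto
  finally show ?thesis by simp
qed

text \<open>The pairs are \<open>i\<close> and \<open>i + n\<close>, one position from the sample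
  and one from the ghost sample; \<open>J\<close> selects the pairs to exchange. The map is an
  involution that fixes every index outside the selected pairs.\<close>

definition swap_pairs :: "nat \<Rightarrow> nat set \<Rightarrow> nat \<Rightarrow> nat" where
  "swap_pairs n J i = (if i < n \<and> i \<in> J then i + n
     else if n \<le> i \<and> i < 2 * n \<and> i - n \<in> J then i - n else i)"

text \<open>\<open>I\<close> stands for the positions whose point lies in a given member of the
  class, so the two terms are the roots of its frequencies in the sample and in the ghost
  sample.\<close>

definition sqrt_gap :: "nat \<Rightarrow> nat set \<Rightarrow> real" where
  "sqrt_gap n I = \<bar>sqrt (card (I \<inter> {..<n}) / n) - sqrt (card (I \<inter> {n..<2 * n}) / n)\<bar>"

lemma card_halves:
  fixes n :: nat
  shows
  "real (card (I \<inter> {..<n})) = (\<Sum>i<n. of_bool (i \<in> I))"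
  "real (card (I \<inter> {n..<2 * n})) = (\<Sum>i<n. of_bool (i + n \<in> I))"
proof -
  show "real (card (I \<inter> {..<n})) = (\<Sum>i<n. of_bool (i \<in> I))"
    by (subst sum_of_bool_eq) (simp_all add: Int_commute)
  have "(\<Sum>i<n. of_bool (i + n \<in> I)) = (\<Sum>i\<in>{n..<2 * n}. of_bool (i \<in> I) :: real)"
    using sum.shift_bounds_nat_ivl[of "\<lambda>i. of_bool (i \<in> I) :: real" 0 n n]
    by (simp add: mult_2 lessThan_atLeast0)
  then show "real (card (I \<inter> {n..<2 * n})) = (\<Sum>i<n. of_bool (i + n \<in> I))"
    by (subst sum_of_bool_eq) (simp_all add: Int_commute)
qed

text \<open>\<open>c i\<close> is nonzero exactly when \<open>I\<close> splits the pair
  \<open>i\<close>, \<open>i + n\<close>, and a swap only flips its sign, so \<open>m\<close> counts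
  the split pairs for every \<open>J\<close>. As \<open>m \<le> a + b\<close>, a gap of
  \<open>s\<close> forces the signed sum to be at least \<open>s * sqrt (n * m)\<close> in absolute
  value, and \<open>m\<close> cancels in the exponent of the tail bound. This is why the result does
  not depend on \<open>I\<close>.\<close>

lemma card_swaps_sqrt_gap:
  assumes n: "0 < n" and s: "0 < s"
  shows "card {J \<in> Pow {..<n}. s \<le> sqrt_gap n {i \<in> {..<2 * n}. swap_pairs n J i \<in> I}}
           \<le> 2 * 2 ^ n * exp (- (n * s\<^sup>2 / 2))"
proof -
  define c :: "nat \<Rightarrow> real" where "c i = of_bool (i \<in> I) - of_bool (i + n \<in> I)" for i
  define m where "m = (\<Sum>i<n. (c i)\<^sup>2)"
  let ?S = "\<lambda>J. \<Sum>i<n. if i \<in> J then - c i else c i"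
  have m0: "0 \<le> m" by (auto simp: m_def intro: sum_nonneg)
  have key: "0 < m \<and> s * sqrt (n * m) \<le> \<bar>?S J\<bar>"
    if J: "J \<subseteq> {..<n}" and gap: "s \<le> sqrt_gap n {i \<in> {..<2 * n}. swap_pairs n J i \<in> I}" for J
  proof -
    let ?K = "{i \<in> {..<2 * n}. swap_pairs n J i \<in> I}"
    define a where "a = real (card (?K \<inter> {..<n}))"
    define b where "b = real (card (?K \<inter> {n..<2 * n}))"
    have a: "a = (\<Sum>i<n. of_bool (if i \<in> J then i + n \<in> I else i \<in> I))"
      unfolding a_def card_halves by (intro sum.cong) (auto simp: swap_pairs_def)
    have b: "b = (\<Sum>i<n. of_bool (if i \<in> J then i \<in> I else i + n \<in> I))"
      unfolding b_def card_halves by (intro sum.cong) (auto simp: swap_pairs_def)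
    have ab: "a - b = ?S J"
      unfolding a b sum_subtractf[symmetric] by (intro sum.cong) (auto simp: c_def)
    have "m \<le> a + b"
      unfolding a b m_def sum.distrib[symmetric] by (intro sum_mono) (auto simp: c_def)
    have a0: "0 \<le> a" and b0: "0 \<le> b" by (auto simp: a_def b_def)
    have "s \<le> \<bar>sqrt a - sqrt b\<bar> / sqrt n"
      using gap n unfolding sqrt_gap_def a_def[symmetric] b_def[symmetric]
      by (simp add: real_sqrt_divide diff_divide_distrib[symmetric])
    then have "s * sqrt n \<le> \<bar>sqrt a - sqrt b\<bar>" using n by (simp add: pos_le_divide_eq)
    moreover have "sqrt m \<le> sqrt a + sqrt b"
      using \<open>m \<le> a + b\<close> sqrt_add_le_add_sqrt[OF a0 b0] by (meson order_trans real_sqrt_le_mono)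
    ultimately have "s * sqrt n * sqrt m \<le> \<bar>sqrt a - sqrt b\<bar> * (sqrt a + sqrt b)"
      using s m0 by (intro mult_mono) auto
    also have "\<dots> = \<bar>(sqrt a - sqrt b) * (sqrt a + sqrt b)\<bar>" using a0 b0 by (simp add: abs_mult)
    also have "(sqrt a - sqrt b) * (sqrt a + sqrt b) = a - b"
      using a0 b0 by (simp add: algebra_simps)
    finally have 1: "s * sqrt (n * m) \<le> \<bar>?S J\<bar>" by (simp add: ab real_sqrt_mult mult.assoc)
    \<comment> \<open>The tail bound divides by \<open>m\<close>. If no pair is split, both halves
      have equal counts whatever is swapped, and the gap is zero.\<close>
    have "m \<noteq> 0"
    proof
      assume "m = 0"
      then have "c i = 0" if "i < n" for i
        using that by (auto simp: m_def sum_nonneg_eq_0_iff)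
      then have "?S J = 0" by (intro sum.neutral) auto
      then have "a = b" using ab by simp
      then show False using \<open>s * sqrt n \<le> \<bar>sqrt a - sqrt b\<bar>\<close> s n
        by (simp add: mult_le_0_iff)
    qed
    then show ?thesis using 1 m0 by simp
  qed
  let ?B = "{J \<in> Pow {..<n}. s \<le> sqrt_gap n {i \<in> {..<2 * n}. swap_pairs n J i \<in> I}}"
  show ?thesis
  proof (cases "0 < m")
    case True
    have "?B \<subseteq> {J \<in> Pow {..<n}. s * sqrt (n * m) \<le> \<bar>?S J\<bar>}" using key by auto
    then have "card ?B \<le> card {J \<in> Pow {..<n}. s * sqrt (n * m) \<le> \<bar>?S J\<bar>}"
      by (intro card_mono) auto
    also have "real \<dots> \<le> 2 * 2 ^ card {..<n} * exp (- (s * sqrt (n * m))\<^sup>2 / (2 * m))"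
      using True s by (intro rademacher_tail) (auto simp: m_def)
    also have "- (s * sqrt (n * m))\<^sup>2 / (2 * m) = - (n * s\<^sup>2 / 2)"
      using True by (simp add: power_mult_distrib)
    finally show ?thesis by simp
  next
    case False
    then have "?B = {}" using key by auto
    then show ?thesis by (simp only: card.empty) simp
  qed
qed

subsection \<open>Uniform deviations\<close>

lemma swap_pairs_less: "i < 2 * n \<Longrightarrow> swap_pairs n J i < 2 * n"
  by (auto simp: swap_pairs_def)

lemma inj_on_swap_pairs: "inj_on (swap_pairs n J) {..<2 * n}"
  by (auto simp: inj_on_def swap_pairs_def split: if_splits)

lemma distr_swap_pairs:
  assumes "prob_space P"
  shows "distr (iid_sample (2 * n) P) (iid_sample (2 * n) P)
            (\<lambda>\<omega>. \<lambda>i\<in>{..<2 * n}. \<omega> (swap_pairs n J i)) = iid_sample (2 * n) P"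
  unfolding iid_sample_def
  using distr_PiM_reindex[of "{..<2 * n}" "\<lambda>_. P" "swap_pairs n J" "{..<2 * n}"] assms
  by (auto simp: inj_on_swap_pairs swap_pairs_less)

lemma prob_space_iid_sample: "prob_space P \<Longrightarrow> prob_space (iid_sample n P)"
  unfolding iid_sample_def by (intro prob_space_PiM)

text \<open>Invariance under each swap makes the measure of \<open>D\<close> equal to its average
  over all \<open>2 ^ n\<close> swaps, and this average can be bounded pointwise. For fixed
  \<open>\<omega>\<close> the class shows only finitely many patterns, so the union bound runs over
  at most \<open>(2 * n + 1) ^ d\<close> of them. \<open>D\<close> is only required to lie inside
  the gap event, which itself may fail to be measurable.\<close>

lemma symmetrized_tail:
  assumes P: "prob_space P" and vc: "vc_dim \<H> = enat d" and n: "0 < n" and s: "0 < s"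
    and D: "D \<in> sets (iid_sample (2 * n) P)"
    and sub: "\<And>\<omega>. \<omega> \<in> D \<Longrightarrow> \<exists>H\<in>\<H>. s \<le> sqrt_gap n {i \<in> {..<2 * n}. \<omega> i \<in> H}"
  shows "emeasure (iid_sample (2 * n) P) D \<le> ennreal (2 * (2 * real n + 1) ^ d * exp (- (n * s\<^sup>2 / 2)))"
proof -
  let ?M = "iid_sample (2 * n) P"
  let ?T = "\<lambda>J \<omega>. \<lambda>i\<in>{..<2 * n}. \<omega> (swap_pairs n J i)"
  let ?b = "2 * (2 * real n + 1) ^ d * exp (- (n * s\<^sup>2 / 2)) :: real"
  interpret M: prob_space ?M by (rule prob_space_iid_sample[OF P])
  have T[measurable]: "?T J \<in> ?M \<rightarrow>\<^sub>M ?M" for J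
    unfolding iid_sample_def using swap_pairs_less
    by (intro measurable_restrict measurable_component_singleton) auto
  note D[measurable]
  have pw: "(\<Sum>J\<in>Pow {..<n}. indicator D (?T J \<omega>)) \<le> ennreal (2 ^ n * ?b)" for \<omega>
  proof -
    let ?pats = "(\<lambda>H. {i \<in> {..<2 * n}. \<omega> i \<in> H}) ` \<H>"
    let ?B = "\<lambda>I. {J \<in> Pow {..<n}. s \<le> sqrt_gap n {i \<in> {..<2 * n}. swap_pairs n J i \<in> I}}"
    have "{J \<in> Pow {..<n}. ?T J \<omega> \<in> D} \<subseteq> (\<Union>I\<in>?pats. ?B I)"
    proof
      fix J assume J: "J \<in> {J \<in> Pow {..<n}. ?T J \<omega> \<in> D}"
      then obtain H where H: "H \<in> \<H>" "s \<le> sqrt_gap n {i \<in> {..<2 * n}. ?T J \<omega> i \<in> H}"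
        using sub[of "?T J \<omega>"] by auto
      \<comment> \<open>The pattern seen after a swap is the preimage under
        \<open>swap_pairs\<close> of the pattern of the original sample, so the union bound ranges
        over patterns that do not depend on \<open>J\<close>.\<close>
      have "{i \<in> {..<2 * n}. ?T J \<omega> i \<in> H}
          = {i \<in> {..<2 * n}. swap_pairs n J i \<in> {i \<in> {..<2 * n}. \<omega> i \<in> H}}"
        using swap_pairs_less by auto
      then have "J \<in> ?B {i \<in> {..<2 * n}. \<omega> i \<in> H}" using H(2) J by (simp only: mem_Collect_eq)
      then show "J \<in> (\<Union>I\<in>?pats. ?B I)" by (rule UN_I[OF imageI[OF H(1)]])
    qed
    then have "card {J \<in> Pow {..<n}. ?T J \<omega> \<in> D} \<le> card (\<Union>I\<in>?pats. ?B I)"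
      by (rule card_mono[rotated]) (rule finite_subset[of _ "Pow {..<n}"], auto)
    also have "\<dots> \<le> (\<Sum>I\<in>?pats. card (?B I))"
      by (rule card_UN_le) (rule card_patterns_le(2)[OF vc], simp)
    finally have "real (card {J \<in> Pow {..<n}. ?T J \<omega> \<in> D}) \<le> real (\<Sum>I\<in>?pats. card (?B I))"
      by (rule of_nat_mono)
    also have "\<dots> \<le> (\<Sum>I\<in>?pats. 2 * 2 ^ n * exp (- (n * s\<^sup>2 / 2)))"
      unfolding of_nat_sum by (intro sum_mono card_swaps_sqrt_gap n s)
    also have "\<dots> = card ?pats * (2 * 2 ^ n * exp (- (n * s\<^sup>2 / 2)))" by simp
    also have "\<dots> \<le> real ((2 * n + 1) ^ d) * (2 * 2 ^ n * exp (- (n * s\<^sup>2 / 2)))"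
      using card_patterns_le(1)[OF vc, of "{..<2 * n}" \<omega>]
      by (intro mult_right_mono) (simp_all flip: of_nat_power)
    also have "\<dots> = 2 ^ n * ?b" by (simp add: add.commute)
    finally have card: "real (card {J \<in> Pow {..<n}. ?T J \<omega> \<in> D}) \<le> 2 ^ n * ?b" .
    have "(\<Sum>J\<in>Pow {..<n}. indicator D (?T J \<omega>))
        = (\<Sum>J\<in>Pow {..<n}. of_bool (?T J \<omega> \<in> D) :: ennreal)"
      by (intro sum.cong) (auto simp: indicator_def)
    also have "\<dots> = of_nat (card {J \<in> Pow {..<n}. ?T J \<omega> \<in> D})"
      by (subst sum_of_bool_eq) (auto intro!: arg_cong[where f = card])
    also have "\<dots> = ennreal (real (card {J \<in> Pow {..<n}. ?T J \<omega> \<in> D}))"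
      by (simp add: ennreal_of_nat_eq_real_of_nat)
    also have "\<dots> \<le> ennreal (2 ^ n * ?b)" using card by (rule ennreal_leI)
    finally show ?thesis .
  qed
  have inv: "emeasure ?M D = (\<integral>\<^sup>+\<omega>. indicator D (?T J \<omega>) \<partial>?M)" for J
  proof -
    have "emeasure ?M D = emeasure (distr ?M ?M (?T J)) D" by (simp add: distr_swap_pairs[OF P])
    also have "\<dots> = (\<integral>\<^sup>+\<omega>. indicator D \<omega> \<partial>distr ?M ?M (?T J))"
      using D by (intro nn_integral_indicator[symmetric]) simp
    also have "\<dots> = (\<integral>\<^sup>+\<omega>. indicator D (?T J \<omega>) \<partial>?M)"
      by (rule nn_integral_distr) measurable
    finally show ?thesis .
  qed
  have "ennreal (2 ^ n) * emeasure ?M D = (\<Sum>J\<in>Pow {..<n}. emeasure ?M D)"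
    by (simp add: card_Pow ennreal_power[symmetric])
  also have "\<dots> = (\<Sum>J\<in>Pow {..<n}. \<integral>\<^sup>+\<omega>. indicator D (?T J \<omega>) \<partial>?M)"
    by (intro sum.cong refl inv)
  also have "\<dots> = (\<integral>\<^sup>+\<omega>. (\<Sum>J\<in>Pow {..<n}. indicator D (?T J \<omega>)) \<partial>?M)"
    by (intro nn_integral_sum[symmetric]) measurable
  also have "\<dots> \<le> (\<integral>\<^sup>+\<omega>. ennreal (2 ^ n * ?b) \<partial>?M)" by (intro nn_integral_mono pw)
  also have "\<dots> = ennreal (2 ^ n) * ennreal ?b"
    by (simp add: M.emeasure_space_1 ennreal_mult[symmetric])
  finally show ?thesis
    by (subst (asm) ennreal_mult_le_mult_iff) (auto simp: add.commute)
qed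

text \<open>The gap depends on the member of the class only through its index pattern, so the event
  is a finite union of those covered by \<open>sample_measurable\<close> at sample size
  \<open>2 * n\<close>.\<close>

lemma sqrt_gap_event_completion:
  assumes "sample_measurable P \<H>"
  shows "{\<omega> \<in> space (iid_sample (2 * n) P). \<exists>H\<in>\<H>. s \<le> sqrt_gap n {i \<in> {..<2 * n}. \<omega> i \<in> H}}
           \<in> sets (completion (iid_sample (2 * n) P))"
proof -
  let ?M = "iid_sample (2 * n) P"
  let ?Q = "\<lambda>I. {\<omega> \<in> space ?M. \<exists>H\<in>\<H>. \<forall>i<2 * n. \<omega> i \<in> H \<longleftrightarrow> i \<in> I}"
  have *: "{i \<in> {..<2 * n}. \<omega> i \<in> H} = I \<longleftrightarrow> (\<forall>i<2 * n. \<omega> i \<in> H \<longleftrightarrow> i \<in> I)"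
    if "I \<subseteq> {..<2 * n}" for I H and \<omega> :: "nat \<Rightarrow> 'a"
    using that by auto
  have "{\<omega> \<in> space ?M. \<exists>H\<in>\<H>. s \<le> sqrt_gap n {i \<in> {..<2 * n}. \<omega> i \<in> H}}
      = (\<Union>I\<in>{I \<in> Pow {..<2 * n}. s \<le> sqrt_gap n I}. ?Q I)" (is "?L = ?R")
  proof (intro set_eqI iffI)
    fix \<omega> assume "\<omega> \<in> ?L"
    then obtain H where H: "\<omega> \<in> space ?M" "H \<in> \<H>" "s \<le> sqrt_gap n {i \<in> {..<2 * n}. \<omega> i \<in> H}"
      by (simp only: mem_Collect_eq) metis
    have "\<omega> \<in> ?Q {i \<in> {..<2 * n}. \<omega> i \<in> H}" using H(1,2) by auto
    moreover have "{i \<in> {..<2 * n}. \<omega> i \<in> H} \<in> {I \<in> Pow {..<2 * n}. s \<le> sqrt_gap n I}"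
      using H(3) by auto
    ultimately show "\<omega> \<in> ?R" by (rule UN_I[rotated])
  next
    fix \<omega> assume "\<omega> \<in> ?R"
    then obtain I where "I \<in> {I \<in> Pow {..<2 * n}. s \<le> sqrt_gap n I}" and Q: "\<omega> \<in> ?Q I"
      by (rule UN_E)
    then have I: "I \<subseteq> {..<2 * n}" "s \<le> sqrt_gap n I" by simp_all
    obtain H where H: "H \<in> \<H>" "\<forall>i<2 * n. \<omega> i \<in> H \<longleftrightarrow> i \<in> I" using Q by (simp only: mem_Collect_eq) metis
    then have "{i \<in> {..<2 * n}. \<omega> i \<in> H} = I" using *[OF I(1)] by simp
    then have "s \<le> sqrt_gap n {i \<in> {..<2 * n}. \<omega> i \<in> H}" using I(2) by (simp only:)
    then show "\<omega> \<in> ?L" using H(1) Q by (simp only: mem_Collect_eq) metis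
  qed
  also have "\<dots> \<in> sets (completion ?M)"
    using assms unfolding sample_measurable_def by (intro sets.finite_UN) auto
  finally show ?thesis .
qed

section \<open>Second moment and concentration of a single frequency\<close>

lemma second_moment_centered_count:
  fixes p :: real
  assumes P: "prob_space P" and H: "H \<in> sets P" and K: "finite K"
  defines "p \<equiv> measure P H"
  shows "integrable (PiM K (\<lambda>_. P)) (\<lambda>y. (\<Sum>i\<in>K. indicator H (y i) - p)\<^sup>2 :: real)"
    and "(\<integral>y. (\<Sum>i\<in>K. indicator H (y i) - p)\<^sup>2 \<partial>PiM K (\<lambda>_. P)) = card K * (p * (1 - p))"
proof -
  interpret P: prob_space P by (rule P)
  interpret PP: product_prob_space "\<lambda>_. P" by unfold_locales
  define g :: "'a \<Rightarrow> real" where "g x = indicator H x - p" for x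
  note H[measurable]
  have g[measurable]: "g \<in> borel_measurable P" unfolding g_def by measurable
  have gb: "\<bar>g x\<bar> \<le> 1" for x
    unfolding g_def p_def using P.prob_le_1[of H] measure_nonneg[of P H]
    by (cases "x \<in> H") (auto simp: abs_le_iff intro: order_trans)
  have ig: "integrable P g"
    by (rule P.integrable_const_bound[where B = 1]) (auto simp: gb)
  have "\<bar>g x * g x\<bar> \<le> 1" for x
    using gb[of x] by (simp add: abs_mult mult_le_one del: abs_mult_self_eq)
  then have igg: "integrable P (\<lambda>x. g x * g x)"
    by (intro P.integrable_const_bound[where B = 1]) auto
  have Eg: "(\<integral>x. g x \<partial>P) = 0"
    unfolding g_def p_def using P.prob_space
    by (subst Bochner_Integration.integral_diff) (auto simp: P.emeasure_eq_measure)
  have "g x * g x = indicator H x * (1 - 2 * p) + p * p" for x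
    by (auto simp: g_def indicator_def algebra_simps)
  then have "(\<integral>x. g x * g x \<partial>P) = (\<integral>x. indicator H x * (1 - 2 * p) + p * p \<partial>P)" by simp
  also have "\<dots> = p * (1 - 2 * p) + p * p"
    using P.prob_space
    by (subst Bochner_Integration.integral_add) (auto simp: P.emeasure_eq_measure p_def)
  finally have Egg: "(\<integral>x. g x * g x \<partial>P) = p * (1 - p)" by (simp add: algebra_simps)
  \<comment> \<open>Integrals of products over \<open>PiM\<close> need one factor per coordinate.
    These factors are 1 away from \<open>i\<close> and \<open>j\<close>, and the factor is
    \<open>g\<close> squared when \<open>i = j\<close>; off the diagonal a mean-zero factor
    remains.\<close>
  define f where "f i j k x = (if k = i then g x else 1) * (if k = j then g x else 1)"
    for i j k :: 'b and x
  have f: "integrable P (f i j k)" for i j k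
    unfolding f_def[abs_def] using ig igg by (cases "k = i"; cases "k = j") auto
  have prod_f: "(\<Prod>k\<in>K. f i j k (y k)) = g (y i) * g (y j)" if "i \<in> K" "j \<in> K" for i j y
    unfolding f_def prod.distrib using that K by (simp add: prod.delta)
  have int: "integrable (PiM K (\<lambda>_. P)) (\<lambda>y. g (y i) * g (y j))" if "i \<in> K" "j \<in> K" for i j
    using PP.product_integrable_prod[OF K, of "f i j"] f prod_f[OF that] by simp
  have val: "(\<integral>y. g (y i) * g (y j) \<partial>PiM K (\<lambda>_. P)) = (if i = j then p * (1 - p) else 0)"
    if ij: "i \<in> K" "j \<in> K" for i j
  proof -
    have "(\<integral>y. g (y i) * g (y j) \<partial>PiM K (\<lambda>_. P)) = (\<Prod>k\<in>K. integral\<^sup>L P (f i j k))"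
      using PP.product_integral_prod[OF K, of "f i j"] f prod_f[OF ij] by simp
    also have "\<dots> = (if i = j then p * (1 - p) else 0)"
    proof (cases "i = j")
      case True
      then have "(\<Prod>k\<in>K. integral\<^sup>L P (f i j k)) = (\<Prod>k\<in>K. if k = i then p * (1 - p) else 1)"
        using Egg P.prob_space by (intro prod.cong) (auto simp: f_def[abs_def])
      then show ?thesis using True ij K by (simp add: prod.delta)
    next
      case False
      then have "integral\<^sup>L P (f i j i) = 0" using Eg by (simp add: f_def[abs_def])
      then show ?thesis using False ij K by (auto intro: prod_zero)
    qed
    finally show ?thesis .
  qed
  have sq: "(\<Sum>i\<in>K. indicator H (y i) - p)\<^sup>2 = (\<Sum>i\<in>K. \<Sum>j\<in>K. g (y i) * g (y j))" for y :: "'b \<Rightarrow> 'a"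
    unfolding g_def power2_eq_square sum_product ..
  show "integrable (PiM K (\<lambda>_. P)) (\<lambda>y. (\<Sum>i\<in>K. indicator H (y i) - p)\<^sup>2 :: real)"
    unfolding sq by (intro Bochner_Integration.integrable_sum int)
  have "(\<integral>y. (\<Sum>i\<in>K. \<Sum>j\<in>K. g (y i) * g (y j)) \<partial>PiM K (\<lambda>_. P))
      = (\<Sum>i\<in>K. \<integral>y. (\<Sum>j\<in>K. g (y i) * g (y j)) \<partial>PiM K (\<lambda>_. P))"
    by (intro Bochner_Integration.integral_sum Bochner_Integration.integrable_sum int)
  also have "\<dots> = (\<Sum>i\<in>K. \<Sum>j\<in>K. \<integral>y. g (y i) * g (y j) \<partial>PiM K (\<lambda>_. P))"
    by (intro sum.cong refl Bochner_Integration.integral_sum int)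
  also have "\<dots> = (\<Sum>i\<in>K. \<Sum>j\<in>K. if i = j then p * (1 - p) else 0)"
    by (intro sum.cong refl val)
  also have "\<dots> = card K * (p * (1 - p))" using K by (simp add: sum.delta)
  finally show "(\<integral>y. (\<Sum>i\<in>K. indicator H (y i) - p)\<^sup>2 \<partial>PiM K (\<lambda>_. P)) = card K * (p * (1 - p))"
    unfolding sq .
qed

text \<open>Chebyshev on the square-root scale: a gap of \<open>s\<close> forces the frequency to
  deviate by at least \<open>s * sqrt p\<close>, and \<open>p\<close> cancels against the variance
  \<open>n * p * (1 - p)\<close> of the count. The condition \<open>2 \<le> n * s\<^sup>2\<close>
  then leaves failure probability at most 1/2. It will be applied to the ghost sample, for one fixed
  \<open>H\<close>.\<close>

lemma prob_sqrt_frequency_close: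
  fixes n :: nat and s :: real
  assumes P: "prob_space P" and H: "H \<in> sets P" and K: "finite K" "card K = n" "0 < n"
    and s: "0 < s" "2 \<le> n * s\<^sup>2"
  defines "G \<equiv> {y \<in> space (PiM K (\<lambda>_. P)).
                  \<bar>sqrt (measure P H) - sqrt (card {i \<in> K. y i \<in> H} / n)\<bar> < s}"
  shows "G \<in> sets (PiM K (\<lambda>_. P))" "1 / 2 \<le> measure (PiM K (\<lambda>_. P)) G"
proof -
  interpret P: prob_space P by (rule P)
  let ?M = "PiM K (\<lambda>_. P)"
  interpret M: prob_space ?M by (intro prob_space_PiM P)
  define p where "p = measure P H"
  have p0: "0 \<le> p" and p1: "p \<le> 1" by (auto simp: p_def)
  define Z where "Z y = (\<Sum>i\<in>K. indicator H (y i) - p)" for y :: "'b \<Rightarrow> 'a"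
  note H[measurable]
  have cnt: "real (card {i \<in> K. y i \<in> H}) = (\<Sum>i\<in>K. indicator H (y i))" for y
    using K by (simp add: indicator_def sum.If_cases Int_def)
  have Z: "Z y = card {i \<in> K. y i \<in> H} - n * p" for y
    using K by (simp add: Z_def cnt sum_subtractf)
  have Zm[measurable]: "Z \<in> borel_measurable ?M"
    unfolding Z_def by measurable
  have G_eq: "G = {y \<in> space ?M. \<bar>sqrt p - sqrt ((Z y + n * p) / n)\<bar> < s}"
    by (simp add: G_def Z p_def)
  show Gs: "G \<in> sets ?M" unfolding G_eq by measurable
  note m2 = second_moment_centered_count[OF P H K(1), folded p_def, folded Z_def]
  have bad: "(n * s)\<^sup>2 * p \<le> (Z y)\<^sup>2 \<and> Z y \<noteq> 0" if "y \<in> space ?M - G" for y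
  proof -
    define q where "q = card {i \<in> K. y i \<in> H} / n"
    have q0: "0 \<le> q" by (simp add: q_def)
    have Zq: "Z y = n * (q - p)" using K by (simp add: Z q_def field_simps)
    have gap: "s \<le> \<bar>sqrt p - sqrt q\<bar>" using that by (auto simp: G_def p_def q_def)
    have "s * sqrt p \<le> \<bar>sqrt p - sqrt q\<bar> * (sqrt p + sqrt q)"
      using s p0 q0 gap by (intro mult_mono) auto
    also have "\<dots> = \<bar>(sqrt p - sqrt q) * (sqrt p + sqrt q)\<bar>" using p0 q0 by (simp add: abs_mult)
    also have "(sqrt p - sqrt q) * (sqrt p + sqrt q) = p - q" using p0 q0 by (simp add: algebra_simps)
    finally have "(s * sqrt p)\<^sup>2 \<le> \<bar>p - q\<bar>\<^sup>2" using s p0 by (intro power_mono) auto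
    then have "s\<^sup>2 * p \<le> (q - p)\<^sup>2" using p0 by (simp add: power_mult_distrib power2_commute)
    then have "(n * s)\<^sup>2 * p \<le> (Z y)\<^sup>2"
      unfolding Zq power_mult_distrib mult.assoc by (intro mult_left_mono) auto
    moreover have "Z y \<noteq> 0" using gap s K by (auto simp: Zq)
    ultimately show ?thesis ..
  qed
  have "measure ?M (space ?M - G) \<le> 1 / 2"
  proof (cases "p = 0")
    \<comment> \<open>At \<open>p = 0\<close> the threshold in Markov's inequality is zero and gives
      nothing. Here the second moment vanishes, while \<open>Z\<close> is nonzero at bad
      points.\<close>
    case True
    have "(\<integral>y. (Z y)\<^sup>2 \<partial>?M) = 0" using m2(2) True by simp
    then have "AE y in ?M. (Z y)\<^sup>2 = 0"
      using integral_nonneg_eq_0_iff_AE[OF m2(1)] by simp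
    then have "AE y in ?M. y \<notin> space ?M - G"
      by (rule AE_mp) (rule AE_I2, use bad True in fastforce)
    then have "measure ?M (space ?M - G) = 0"
      using Gs by (subst M.prob_eq_0) auto
    then show ?thesis by simp
  next
    case False
    then have pp: "0 < p" using p0 by simp
    let ?a = "(n * s)\<^sup>2 * p"
    have a: "0 < ?a" using pp s K by simp
    have "measure ?M (space ?M - G) \<le> measure ?M {y \<in> space ?M. ?a \<le> (Z y)\<^sup>2}"
      using bad pp by (intro M.finite_measure_mono) fastforce+
    also have "\<dots> \<le> (\<integral>y. (Z y)\<^sup>2 \<partial>?M) / ?a"
      using a by (intro integral_Markov_inequality_measure[where A = "{}", OF m2(1)]) auto
    also have "\<dots> = (n * p * (1 - p)) / (n * (n * s\<^sup>2) * p)"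
      using m2(2) K by (simp add: power_mult_distrib power2_eq_square mult_ac)
    also have "\<dots> = (1 - p) / (n * s\<^sup>2)" using pp K by simp
    also have "\<dots> \<le> 1 / 2" using s p0 p1 by (intro frac_le) auto
    finally show ?thesis .
  qed
  then show "1 / 2 \<le> measure ?M G" using M.prob_compl[OF Gs] by simp
qed

text \<open>Ghost-sample argument by sections: \<open>E\<close> collects the samples whose section
  of the bad set \<open>D1\<close> has measure below 1/2. If some \<open>H\<close> deviated by more
  than \<open>2 * s\<close> on such a sample, a ghost frequency within \<open>s\<close> of the
  truth, which has probability at least 1/2, would leave a gap of at least \<open>s\<close>: a
  contradiction. Markov at level 1/2 turns the factor 2 of the swap bound into 4.\<close>

lemma uniform_sqrt_deviation:
  fixes s :: real
  assumes P: "prob_space P" and vc: "vc_dim \<H> = enat d"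
    and sets: "\<And>H. H \<in> \<H> \<Longrightarrow> H \<in> sets P" and sm: "sample_measurable P \<H>"
    and n: "0 < n" and s: "0 < s" "2 \<le> n * s\<^sup>2"
  shows "\<exists>E\<in>sets (iid_sample n P).
     1 - 4 * (2 * real n + 1) ^ d * exp (- (n * s\<^sup>2 / 2)) \<le> measure (iid_sample n P) E \<and>
     (\<forall>\<omega>\<in>E. \<forall>H\<in>\<H>. \<bar>sqrt (measure P H) - sqrt (card {i \<in> {..<n}. \<omega> i \<in> H} / n)\<bar> \<le> 2 * s)"
proof -
  interpret P: prob_space P by (rule P)
  interpret PP: product_prob_space "\<lambda>_::nat. P" by unfold_locales
  let ?I = "{..<n}" and ?J = "{n..<2 * n}"
  let ?M = "iid_sample (2 * n) P"
  interpret I: prob_space "iid_sample n P" by (rule prob_space_iid_sample[OF P])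
  interpret J: prob_space "PiM ?J (\<lambda>_. P)" by (intro prob_space_PiM P)
  have IJ: "?I \<inter> ?J = {}" "?I \<union> ?J = {..<2 * n}" by auto
  let ?b = "2 * (2 * real n + 1) ^ d * exp (- (n * s\<^sup>2 / 2)) :: real"
  let ?D = "{\<omega> \<in> space ?M. \<exists>H\<in>\<H>. s \<le> sqrt_gap n {i \<in> {..<2 * n}. \<omega> i \<in> H}}"
  obtain S N N' where SN: "?D = S \<union> N" "N \<subseteq> N'" "N' \<in> null_sets ?M" "S \<in> sets ?M"
    by (rule sets_completionE[OF sqrt_gap_event_completion[OF sm, of n s]])
  \<comment> \<open>\<open>?D\<close> is measurable only in the completion. Adding the null set
    \<open>N'\<close> to \<open>S\<close> gives a measurable superset of \<open>?D\<close> with the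
    measure of \<open>S\<close>, to which integration over sections applies.\<close>
  define D1 where "D1 = S \<union> N'"
  have D1: "D1 \<in> sets ?M" "?D \<subseteq> D1" using SN by (auto simp: D1_def)
  have "emeasure ?M D1 = emeasure ?M S"
    unfolding D1_def by (rule emeasure_Un_null_set[OF SN(4,3)])
  also have "\<dots> \<le> ennreal ?b"
  \<comment> \<open>The swap bound is applied to \<open>S\<close> alone: its points carry a witness
    from the class, which points of \<open>N'\<close> may lack.\<close>
  proof (rule symmetrized_tail[OF P vc n s(1) SN(4)])
    fix \<omega> assume "\<omega> \<in> S"
    then have "\<omega> \<in> ?D" unfolding SN(1) by (rule UnI1)
    then show "\<exists>H\<in>\<H>. s \<le> sqrt_gap n {i \<in> {..<2 * n}. \<omega> i \<in> H}"
      by (simp only: mem_Collect_eq)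
  qed
  finally have D1_le: "emeasure ?M D1 \<le> ennreal ?b" .
  define u where "u \<omega> = emeasure (PiM ?J (\<lambda>_. P))
      ((\<lambda>y. merge ?I ?J (\<omega>, y)) -` D1 \<inter> space (PiM ?J (\<lambda>_. P)))" for \<omega>
  have D1': "D1 \<in> sets (PiM (?I \<union> ?J) (\<lambda>_. P))" using D1 by (simp add: IJ iid_sample_def)
  have u[measurable]: "u \<in> borel_measurable (iid_sample n P)"
    unfolding u_def[abs_def] iid_sample_def
    by (rule PP.emeasure_fold_measurable[OF IJ(1) _ _ D1']) auto
  have uint: "(\<integral>\<^sup>+\<omega>. u \<omega> \<partial>iid_sample n P) = emeasure ?M D1"
    using PP.emeasure_fold_integral[OF IJ(1) _ _ D1'] by (simp add: u_def IJ iid_sample_def)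
  define E where "E = {\<omega> \<in> space (iid_sample n P). u \<omega> < ennreal (1 / 2)}"
  have E: "E \<in> sets (iid_sample n P)" unfolding E_def by measurable
  let ?C = "space (iid_sample n P) - E"
  have "ennreal (1 / 2) * emeasure (iid_sample n P) ?C
      = (\<integral>\<^sup>+\<omega>. ennreal (1 / 2) * indicator ?C \<omega> \<partial>iid_sample n P)"
    using E by (subst nn_integral_cmult_indicator) auto
  also have "\<dots> \<le> (\<integral>\<^sup>+\<omega>. u \<omega> \<partial>iid_sample n P)"
    by (intro nn_integral_mono) (auto simp: E_def indicator_def not_less)
  also have "\<dots> \<le> ennreal ?b" using D1_le by (simp add: uint)
  finally have "ennreal (1 / 2) * ennreal (measure (iid_sample n P) ?C) \<le> ennreal ?b"
    by (simp only: I.emeasure_eq_measure)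
  then have "ennreal (1 / 2 * measure (iid_sample n P) ?C) \<le> ennreal ?b"
    by (subst ennreal_mult) simp_all
  then have "1 / 2 * measure (iid_sample n P) ?C \<le> ?b"
    by (subst (asm) ennreal_le_iff) auto
  then have "1 - 4 * (2 * real n + 1) ^ d * exp (- (n * s\<^sup>2 / 2)) \<le> measure (iid_sample n P) E"
    using I.prob_compl[OF E] by simp
  moreover have "\<bar>sqrt (measure P H) - sqrt (card {i \<in> {..<n}. \<omega> i \<in> H} / n)\<bar> \<le> 2 * s"
    if \<omega>: "\<omega> \<in> E" and H: "H \<in> \<H>" for \<omega> H
  proof (rule ccontr)
    assume far: "\<not> \<bar>sqrt (measure P H) - sqrt (card {i \<in> {..<n}. \<omega> i \<in> H} / n)\<bar> \<le> 2 * s"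
    let ?G = "{y \<in> space (PiM ?J (\<lambda>_. P)).
                  \<bar>sqrt (measure P H) - sqrt (card {i \<in> ?J. y i \<in> H} / n)\<bar> < s}"
    have G: "?G \<in> sets (PiM ?J (\<lambda>_. P))" "1 / 2 \<le> measure (PiM ?J (\<lambda>_. P)) ?G"
      by (rule prob_sqrt_frequency_close[OF P sets[OF H]]; use n s in simp)+
    have "?G \<subseteq> (\<lambda>y. merge ?I ?J (\<omega>, y)) -` D1 \<inter> space (PiM ?J (\<lambda>_. P))"
    proof
      fix y assume y: "y \<in> ?G"
      let ?m = "merge ?I ?J (\<omega>, y)"
      have "(\<omega>, y) \<in> space (PiM ?I (\<lambda>_. P) \<Otimes>\<^sub>M PiM ?J (\<lambda>_. P))"
        using \<omega> y by (auto simp: E_def iid_sample_def space_pair_measure)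
      then have "?m \<in> space (PiM (?I \<union> ?J) (\<lambda>_. P))"
        by (rule measurable_space[OF measurable_merge])
      then have 1: "?m \<in> space ?M" by (simp add: IJ iid_sample_def)
      have 2: "{i \<in> {..<2 * n}. ?m i \<in> H} \<inter> ?I = {i \<in> ?I. \<omega> i \<in> H}"
        "{i \<in> {..<2 * n}. ?m i \<in> H} \<inter> ?J = {i \<in> ?J. y i \<in> H}"
        by (auto simp: merge_def)
      have "s \<le> sqrt_gap n {i \<in> {..<2 * n}. ?m i \<in> H}"
        using far y unfolding sqrt_gap_def 2 mem_Collect_eq by linarith
      then have "?m \<in> ?D" using 1 H by (simp only: mem_Collect_eq) metis
      then have "?m \<in> D1" by (rule subsetD[OF D1(2)])
      then show "y \<in> (\<lambda>y. merge ?I ?J (\<omega>, y)) -` D1 \<inter> space (PiM ?J (\<lambda>_. P))"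
        using y by simp
    qed
    moreover have "merge ?I ?J \<in> PiM ?I (\<lambda>_. P) \<Otimes>\<^sub>M PiM ?J (\<lambda>_. P) \<rightarrow>\<^sub>M PiM (?I \<union> ?J) (\<lambda>_. P)"
      by (rule measurable_merge)
    then have "(\<lambda>y. merge ?I ?J (\<omega>, y)) \<in> PiM ?J (\<lambda>_. P) \<rightarrow>\<^sub>M PiM (?I \<union> ?J) (\<lambda>_. P)"
      using \<omega> by (intro measurable_compose[OF measurable_Pair1'])
        (auto simp: E_def iid_sample_def)
    ultimately have "emeasure (PiM ?J (\<lambda>_. P)) ?G \<le> u \<omega>"
      unfolding u_def using D1' by (intro emeasure_mono measurable_sets) auto
    moreover have "ennreal (1 / 2) \<le> emeasure (PiM ?J (\<lambda>_. P)) ?G"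
      unfolding J.emeasure_eq_measure by (rule ennreal_leI[OF G(2)])
    ultimately have "ennreal (1 / 2) \<le> u \<omega>" by (rule order_trans[rotated])
    then show False using \<omega> by (simp add: E_def not_less[symmetric])
  qed
  ultimately show ?thesis using E by (intro bexI[of _ E] conjI ballI)
qed

subsection \<open>Hellinger distance and threshold sets\<close>

lemma prob_density_integrable:
  assumes "prob_density \<nu> f"
  shows "integrable \<nu> f" "(\<integral>x. f x \<partial>\<nu>) = 1"
proof -
  have [measurable]: "f \<in> borel_measurable \<nu>" and f0: "AE x in \<nu>. 0 \<le> f x"
    and f1: "(\<integral>\<^sup>+x. ennreal (f x) \<partial>\<nu>) = 1"
    using assms by (auto simp: prob_density_def)
  show "integrable \<nu> f" using f0 f1 by (intro integrableI_nonneg) auto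
  show "(\<integral>x. f x \<partial>\<nu>) = 1" using f0 f1 by (subst integral_eq_nn_integral) auto
qed

lemma prob_space_distribution_of: "prob_density \<nu> f \<Longrightarrow> prob_space (distribution_of \<nu> f)"
  by (intro prob_spaceI)
    (auto simp: distribution_of_def prob_density_def emeasure_density cong: nn_integral_cong_simp)

lemma sets_distribution_of [simp]: "sets (distribution_of \<nu> f) = sets \<nu>"
  by (simp add: distribution_of_def)

lemma measure_distribution_of:
  assumes f: "prob_density \<nu> f" and A: "A \<in> sets \<nu>"
  shows "measure (distribution_of \<nu> f) A = (\<integral>x. indicator A x * f x \<partial>\<nu>)"
proof -
  have [measurable]: "f \<in> borel_measurable \<nu>" "A \<in> sets \<nu>"
    and f0: "\<And>x. x \<in> space \<nu> \<Longrightarrow> 0 \<le> f x"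
    using assms by (auto simp: prob_density_def)
  have "emeasure (distribution_of \<nu> f) A = (\<integral>\<^sup>+x. ennreal (f x) * indicator A x \<partial>\<nu>)"
    by (simp add: distribution_of_def emeasure_density)
  also have "\<dots> = (\<integral>\<^sup>+x. ennreal (indicator A x * f x) \<partial>\<nu>)"
    by (intro nn_integral_cong) (auto simp: indicator_def)
  finally show ?thesis
    using f0 by (subst integral_eq_nn_integral) (auto simp: measure_def intro!: AE_I2)
qed

text \<open>Setwise domination gives absolute continuity. The Radon-Nikodym derivative is finite
  almost everywhere, so making it real-valued changes only a null set.\<close>

lemma prob_density_exists:
  assumes \<nu>: "finite_measure \<nu>" and P: "prob_space P" and sets: "sets P = sets \<nu>"
    and le: "\<And>A. A \<in> sets \<nu> \<Longrightarrow> emeasure P A \<le> emeasure \<nu> A"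
  shows "\<exists>f. prob_density \<nu> f \<and> distribution_of \<nu> f = P"
proof -
  interpret \<nu>: finite_measure \<nu> by (rule \<nu>)
  interpret P: prob_space P by (rule P)
  have ac: "absolutely_continuous \<nu> P"
    unfolding absolutely_continuous_def
  proof
    fix N assume "N \<in> null_sets \<nu>"
    then have "N \<in> sets \<nu>" "emeasure \<nu> N = 0" by auto
    then have "emeasure P N = 0" using le[of N] by simp
    then show "N \<in> null_sets P" using \<open>N \<in> sets \<nu>\<close> sets by auto
  qed
  define f where "f x = enn2real (RN_deriv \<nu> P x)" for x
  have [measurable]: "f \<in> borel_measurable \<nu>" unfolding f_def by measurable
  have "AE x in \<nu>. RN_deriv \<nu> P x \<noteq> \<infinity>"
    by (rule \<nu>.RN_deriv_finite[OF P.sigma_finite_measure_axioms ac sets])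
  then have "AE x in \<nu>. ennreal (f x) = RN_deriv \<nu> P x"
    by eventually_elim (simp add: f_def ennreal_enn2real less_top)
  then have "density \<nu> (\<lambda>x. ennreal (f x)) = density \<nu> (RN_deriv \<nu> P)"
    by (intro density_cong) auto
  also have "\<dots> = P" by (rule \<nu>.density_RN_deriv[OF ac sets])
  finally have eq: "distribution_of \<nu> f = P" by (simp add: distribution_of_def)
  have "(\<integral>\<^sup>+x. ennreal (f x) \<partial>\<nu>) = (\<integral>\<^sup>+x. ennreal (f x) * indicator (space \<nu>) x \<partial>\<nu>)"
    by (intro nn_integral_cong) auto
  also have "\<dots> = emeasure (distribution_of \<nu> f) (space \<nu>)"
    by (simp add: distribution_of_def emeasure_density)
  also have "\<dots> = 1" using P.emeasure_space_1 sets_eq_imp_space_eq[OF sets] by (simp add: eq)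
  finally have "prob_density \<nu> f" by (simp add: prob_density_def f_def)
  then show ?thesis using eq by blast
qed

text \<open>\<open>hellinger_sq\<close> uses a separate dominating measure for each pair. The
  triangle inequality involves three pairs, so all three distributions are written over one sum, and
  \<open>hellinger_density\<close> moves each distance there.\<close>

lemma common_densities:
  assumes P: "prob_space P" and Q: "prob_space Q" and R: "prob_space R"
    and sets: "sets Q = sets P" "sets R = sets P"
  obtains \<nu> f g h where "sets \<nu> = sets P" "prob_density \<nu> f" "prob_density \<nu> g" "prob_density \<nu> h"
    "distribution_of \<nu> f = P" "distribution_of \<nu> g = Q" "distribution_of \<nu> h = R"
proof -
  define \<nu> where "\<nu> = plus_measure P (plus_measure Q R)"
  have s: "sets \<nu> = sets P" by (simp add: \<nu>_def)
  have em: "emeasure \<nu> A = emeasure P A + (emeasure Q A + emeasure R A)" if "A \<in> sets P" for A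
    unfolding \<nu>_def using that sets by (simp add: emeasure_plus_measure)
  interpret P: prob_space P by (rule P)
  interpret Q: prob_space Q by (rule Q)
  interpret R: prob_space R by (rule R)
  have "finite_measure \<nu>"
    by (rule finite_measureI)
      (simp add: sets_eq_imp_space_eq[OF s] em P.emeasure_eq_measure Q.emeasure_eq_measure
        R.emeasure_eq_measure)
  note ex = prob_density_exists[OF this]
  obtain f where "prob_density \<nu> f" "distribution_of \<nu> f = P"
    using ex[OF P] s em by auto
  moreover obtain g where "prob_density \<nu> g" "distribution_of \<nu> g = Q"
    using ex[OF Q] s sets em by (metis add.commute le_iff_add add.assoc)
  moreover obtain h where "prob_density \<nu> h" "distribution_of \<nu> h = R"
    using ex[OF R] s sets em by (metis add.commute le_iff_add add.assoc)
  ultimately show ?thesis using that s by blast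
qed

section \<open>Elementary inequalities for the squared Hellinger distance\<close>

lemma integrable_sqrt_diff_sq:
  assumes f: "prob_density \<nu> f" and g: "prob_density \<nu> g"
  shows "integrable \<nu> (\<lambda>x. (sqrt (f x) - sqrt (g x))\<^sup>2)"
    and "integrable \<nu> (\<lambda>x. sqrt (f x) * sqrt (g x))"
proof -
  have [measurable]: "f \<in> borel_measurable \<nu>" "g \<in> borel_measurable \<nu>"
    and f0: "\<And>x. x \<in> space \<nu> \<Longrightarrow> 0 \<le> f x" and g0: "\<And>x. x \<in> space \<nu> \<Longrightarrow> 0 \<le> g x"
    using assms by (auto simp: prob_density_def)
  have int: "integrable \<nu> (\<lambda>x. f x + g x)"
    using prob_density_integrable(1)[OF f] prob_density_integrable(1)[OF g] by simp
  have amgm: "a * b \<le> a\<^sup>2 + b\<^sup>2" if "0 \<le> a" "0 \<le> b" for a b :: real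
    using sum_squares_bound[of a b] that mult_nonneg_nonneg[OF that] by linarith
  have le: "sqrt (f x) * sqrt (g x) \<le> f x + g x" if "x \<in> space \<nu>" for x
    using amgm[of "sqrt (f x)" "sqrt (g x)"] f0[OF that] g0[OF that] by simp
  have le2: "(sqrt (f x) - sqrt (g x))\<^sup>2 \<le> f x + g x" if "x \<in> space \<nu>" for x
    using f0[OF that] g0[OF that] by (simp add: power2_diff)
  show "integrable \<nu> (\<lambda>x. (sqrt (f x) - sqrt (g x))\<^sup>2)"
    using int
  proof (rule Bochner_Integration.integrable_bound)
    show "AE x in \<nu>. norm ((sqrt (f x) - sqrt (g x))\<^sup>2) \<le> norm (f x + g x)"
      using le2 f0 g0 by (intro AE_I2) simp
  qed measurable
  show "integrable \<nu> (\<lambda>x. sqrt (f x) * sqrt (g x))"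
    using int
  proof (rule Bochner_Integration.integrable_bound)
    show "AE x in \<nu>. norm (sqrt (f x) * sqrt (g x)) \<le> norm (f x + g x)"
      using le f0 g0 by (intro AE_I2) simp
  qed measurable
qed

lemma hellinger_sq_nonneg: "0 \<le> hellinger_sq p q"
  by (simp add: hellinger_sq_def)

lemma hellinger_sq_le_1:
  assumes P: "prob_space P" and Q: "prob_space Q" and sets: "sets Q = sets P"
  shows "hellinger_sq P Q \<le> 1"
proof -
  obtain \<nu> f g h where f: "prob_density \<nu> f" and g: "prob_density \<nu> g"
    and eq: "distribution_of \<nu> f = P" "distribution_of \<nu> g = Q"
    using common_densities[OF P Q Q sets sets] by metis
  note i = prob_density_integrable[OF f] prob_density_integrable[OF g]
  have "(\<integral>x. (sqrt (f x) - sqrt (g x))\<^sup>2 \<partial>\<nu>) \<le> (\<integral>x. f x + g x \<partial>\<nu>)"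
    using f g i by (intro integral_mono integrable_sqrt_diff_sq)
      (auto simp: power2_diff prob_density_def)
  also have "\<dots> = 2" using i by simp
  finally show ?thesis using hellinger_density[OF f g] eq by simp
qed

lemma sq_diff_triangle: "(a - c)\<^sup>2 \<le> 2 * (a - b)\<^sup>2 + 2 * (b - c)\<^sup>2" for a b c :: real
  using sum_squares_ge_zero[of "a - 2 * b + c" 0] by (simp add: power2_eq_square algebra_simps)

lemma half_sq_triangle:
  fixes a b c :: real
  shows "1 / 2 * (a - c)\<^sup>2 \<le> 2 * (1 / 2 * (a - b)\<^sup>2) + 2 * (1 / 2 * (b - c)\<^sup>2)"
  using sq_diff_triangle[of a c b] by simp

lemma hellinger_sq_triangle:
  assumes P: "prob_space P" and Q: "prob_space Q" and R: "prob_space R"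
    and sets: "sets Q = sets P" "sets R = sets P"
  shows "hellinger_sq P R \<le> 2 * hellinger_sq P Q + 2 * hellinger_sq Q R"
proof -
  obtain \<nu> f g h where f: "prob_density \<nu> f" and g: "prob_density \<nu> g" and h: "prob_density \<nu> h"
    and eq: "distribution_of \<nu> f = P" "distribution_of \<nu> g = Q" "distribution_of \<nu> h = R"
    using common_densities[OF P Q R sets] by metis
  note i = integrable_sqrt_diff_sq(1)
  have "(\<integral>x. (sqrt (f x) - sqrt (h x))\<^sup>2 \<partial>\<nu>)
      \<le> (\<integral>x. 2 * (sqrt (f x) - sqrt (g x))\<^sup>2 + 2 * (sqrt (g x) - sqrt (h x))\<^sup>2 \<partial>\<nu>)"
    using i[OF f g] i[OF g h] i[OF f h] by (intro integral_mono sq_diff_triangle) auto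
  also have "\<dots> = 2 * (\<integral>x. (sqrt (f x) - sqrt (g x))\<^sup>2 \<partial>\<nu>) + 2 * (\<integral>x. (sqrt (g x) - sqrt (h x))\<^sup>2 \<partial>\<nu>)"
    using i[OF f g] i[OF g h] by simp
  finally show ?thesis
    using hellinger_density[OF f g] hellinger_density[OF g h] hellinger_density[OF f h]
    by (simp add: eq)
qed

text \<open>\<open>sqrt (measure P A)\<close> is the L2 norm of the root density restricted to
  \<open>A\<close>. The inequality is the reverse triangle inequality in L2, followed by enlarging
  \<open>A\<close> to the whole space; Cauchy-Schwarz bounds the cross term
  \<open>?c\<close>.\<close>

lemma sqrt_prob_diff_le_hellinger_sq:
  assumes P: "prob_space P" and Q: "prob_space Q" and sets: "sets Q = sets P" and A: "A \<in> sets P"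
  shows "1 / 2 * (sqrt (measure P A) - sqrt (measure Q A))\<^sup>2 \<le> hellinger_sq P Q"
proof -
  obtain \<nu> f g h where s: "sets \<nu> = sets P" and f: "prob_density \<nu> f" and g: "prob_density \<nu> g"
    and eq: "distribution_of \<nu> f = P" "distribution_of \<nu> g = Q"
    using common_densities[OF P Q Q sets sets] by metis
  have A'[measurable]: "A \<in> sets \<nu>" using A s by simp
  have [measurable]: "f \<in> borel_measurable \<nu>" "g \<in> borel_measurable \<nu>"
    and f0: "\<And>x. x \<in> space \<nu> \<Longrightarrow> 0 \<le> f x" and g0: "\<And>x. x \<in> space \<nu> \<Longrightarrow> 0 \<le> g x"
    using f g by (auto simp: prob_density_def)
  let ?I = "indicator A :: _ \<Rightarrow> real"
  let ?a = "measure P A" and ?b = "measure Q A"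
  let ?c = "\<integral>x. ?I x * (sqrt (f x) * sqrt (g x)) \<partial>\<nu>"
  note mp = measure_distribution_of[OF f A', unfolded eq]
  note mq = measure_distribution_of[OF g A', unfolded eq]
  note i = integrable_sqrt_diff_sq[OF f g]
    prob_density_integrable(1)[OF f] prob_density_integrable(1)[OF g]
  have ii: "integrable \<nu> (\<lambda>x. ?I x * k x)" if "integrable \<nu> k" for k :: "_ \<Rightarrow> real"
    by (rule integrable_mult_indicator[OF A' that, unfolded real_scaleR_def])
  have emp: "emeasure P A = (\<integral>\<^sup>+x. (ennreal (?I x * sqrt (f x)))\<^sup>2 \<partial>\<nu>)"
    unfolding eq(1)[symmetric] distribution_of_def
    by (subst emeasure_density)
      (auto intro!: nn_integral_cong simp: f0 ennreal_power indicator_def)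
  have emq: "emeasure Q A = (\<integral>\<^sup>+x. (ennreal (?I x * sqrt (g x)))\<^sup>2 \<partial>\<nu>)"
    unfolding eq(2)[symmetric] distribution_of_def
    by (subst emeasure_density)
      (auto intro!: nn_integral_cong simp: g0 ennreal_power indicator_def)
  have c: "ennreal ?c = (\<integral>\<^sup>+x. ennreal (?I x * sqrt (f x)) * ennreal (?I x * sqrt (g x)) \<partial>\<nu>)"
    using ii[OF i(2)] f0 g0
    by (subst nn_integral_eq_integral[symmetric])
      (auto intro!: AE_I2 nn_integral_cong simp: indicator_def ennreal_mult)
  have c0: "0 \<le> ?c" using f0 g0 by (intro integral_nonneg_AE AE_I2) simp
  have "(ennreal ?c)\<^sup>2 \<le> emeasure P A * emeasure Q A"
    unfolding c emp emq by (rule Cauchy_Schwarz_nn_integral) measurable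
  then have "ennreal (?c\<^sup>2) \<le> ennreal (?a * ?b)"
    using c0 finite_measure.emeasure_eq_measure[OF prob_space.axioms(1)[OF P]]
      finite_measure.emeasure_eq_measure[OF prob_space.axioms(1)[OF Q]]
    by (simp add: ennreal_power ennreal_mult)
  then have "?c\<^sup>2 \<le> ?a * ?b" by (subst (asm) ennreal_le_iff) auto
  then have cs: "?c \<le> sqrt ?a * sqrt ?b"
    unfolding real_sqrt_mult[symmetric] by (rule real_le_rsqrt)
  have "(sqrt ?a - sqrt ?b)\<^sup>2 = ?a + ?b - 2 * (sqrt ?a * sqrt ?b)" by (simp add: power2_diff)
  also have "\<dots> \<le> ?a + ?b - 2 * ?c" using cs by simp
  also have "\<dots> = (\<integral>x. ?I x * f x + ?I x * g x - 2 * (?I x * (sqrt (f x) * sqrt (g x))) \<partial>\<nu>)"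
    unfolding mp mq using ii[OF i(2)] ii[OF i(3)] ii[OF i(4)] by simp
  also have "\<dots> \<le> (\<integral>x. (sqrt (f x) - sqrt (g x))\<^sup>2 \<partial>\<nu>)"
  proof (rule integral_mono[OF _ i(1)])
    show "integrable \<nu> (\<lambda>x. ?I x * f x + ?I x * g x - 2 * (?I x * (sqrt (f x) * sqrt (g x))))"
      using ii[OF i(2)] ii[OF i(3)] ii[OF i(4)] by simp
    show "?I x * f x + ?I x * g x - 2 * (?I x * (sqrt (f x) * sqrt (g x)))
        \<le> (sqrt (f x) - sqrt (g x))\<^sup>2" if "x \<in> space \<nu>" for x
    proof (cases "x \<in> A")
      case True
      then show ?thesis using f0[OF that] g0[OF that] by (simp add: power2_diff)
    qed simp
  qed
  finally show ?thesis using hellinger_density[OF f g] eq by simp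
qed

section \<open>Dyadic layers of the likelihood ratio\<close>

lemma sqrt_diff_sq_le_layers:
  fixes p q :: real
  assumes p: "0 \<le> p" and q: "0 \<le> q" and qp: "q \<le> p"
  \<comment> \<open>For positive \<open>p\<close>, \<open>B k\<close> says that
    \<open>sqrt p\<close> exceeds \<open>sqrt q\<close> by a relative amount of at least
    \<open>(1/2) ^ k\<close>. The conjunct \<open>0 < p\<close> matches the convention 0 / 0 = 0,
    under which a point where both densities vanish lies in no set with positive threshold.\<close>
  defines "B k \<equiv> (1 + (1/2) ^ k)\<^sup>2 * q \<le> p \<and> 0 < p"
  shows "(sqrt p - sqrt q)\<^sup>2
    \<le> of_bool (B 0) * p + (\<Sum>k=1..K. 4 * (1/4) ^ k * (of_bool (B k) * q)) + (1/4) ^ K * q"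
proof (induction K)
  have le: "(sqrt p - sqrt q)\<^sup>2 \<le> (1/4) ^ k * q" if "\<not> B k" for k
  proof (cases "p = 0")
    case True
    then show ?thesis using q qp by simp
  next
    case False
    then have "p \<le> (1 + (1/2) ^ k)\<^sup>2 * q" using that p by (auto simp: B_def)
    then have "sqrt p \<le> sqrt ((1 + (1/2) ^ k)\<^sup>2 * q)" by (rule real_sqrt_le_mono)
    also have "\<dots> = (1 + (1/2) ^ k) * sqrt q"
      by (simp add: real_sqrt_mult add_nonneg_nonneg)
    finally have "sqrt p - sqrt q \<le> (1/2) ^ k * sqrt q" by (simp add: algebra_simps)
    then have "(sqrt p - sqrt q)\<^sup>2 \<le> ((1/2) ^ k * sqrt q)\<^sup>2"
      using qp by (intro power_mono) auto
    also have "\<dots> = (1/4) ^ k * q"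
      using q by (simp add: power_mult_distrib power_mult[symmetric] mult.commute[of k])
        (simp add: power_mult power2_eq_square)
    finally show ?thesis .
  qed
  have sum0: "0 \<le> (\<Sum>k=1..K. 4 * (1/4) ^ k * (of_bool (B k) * q))" for K
    using q by (intro sum_nonneg) simp
  {
    case 0
    show ?case
    proof (cases "B 0")
      case True
      have "(sqrt p - sqrt q)\<^sup>2 \<le> (sqrt p)\<^sup>2" using q qp by (intro power_mono) auto
      then show ?thesis using True p q by simp
    next
      case False
      then show ?thesis using le[of 0] by simp
    qed
  next
    \<comment> \<open>The factor 4 makes layer \<open>Suc K\<close> equal to the old remainder
      \<open>(1/4) ^ K * q\<close>, which it replaces if \<open>B (Suc K)\<close> holds. If it
      fails, the new remainder alone is enough.\<close>
    case (Suc K)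
    show ?case
    proof (cases "B (Suc K)")
      case True
      then have "(\<Sum>k=1..Suc K. 4 * (1/4) ^ k * (of_bool (B k) * q))
          = (\<Sum>k=1..K. 4 * (1/4) ^ k * (of_bool (B k) * q)) + (1/4) ^ K * q"
        by simp
      moreover have "0 \<le> (1/4) ^ Suc K * q" using q by simp
      ultimately show ?thesis using Suc.IH by linarith
    next
      case False
      have "0 \<le> of_bool (B 0) * p" using p by simp
      then show ?thesis using le[OF False] sum0[of "Suc K"] by linarith
    qed
  }
qed

text \<open>Truncating the dyadic decomposition of \<open>sqrt (p / q)\<close> at level \<open>K\<close> costs \<open>(1/4) ^ K\<close>;
  each of the remaining levels is controlled by a single threshold set.\<close>

lemma one_sided_hellinger_le:
  fixes K :: nat
  assumes p: "prob_density \<mu> p" and q: "prob_density \<mu> q"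
    and D: "\<And>\<tau>::real. 1 / 2 * (sqrt (measure (distribution_of \<mu> p)
                  {x \<in> space \<mu>. ennreal (p x) / ennreal (q x) \<ge> ennreal \<tau>})
              - sqrt (measure (distribution_of \<mu> q)
                  {x \<in> space \<mu>. ennreal (p x) / ennreal (q x) \<ge> ennreal \<tau>}))\<^sup>2 \<le> D"
  shows "(\<integral>x. (if q x \<le> p x then (sqrt (p x) - sqrt (q x))\<^sup>2 else 0) \<partial>\<mu>) \<le> 8 * D * (K + 1) + (1/4) ^ K"
    and "integrable \<mu> (\<lambda>x. (if q x \<le> p x then (sqrt (p x) - sqrt (q x))\<^sup>2 else 0))"
proof -
  have [measurable]: "p \<in> borel_measurable \<mu>" "q \<in> borel_measurable \<mu>"
    and p0: "\<And>x. x \<in> space \<mu> \<Longrightarrow> 0 \<le> p x" and q0: "\<And>x. x \<in> space \<mu> \<Longrightarrow> 0 \<le> q x"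
    using p q by (auto simp: prob_density_def)
  let ?P = "distribution_of \<mu> p" and ?Q = "distribution_of \<mu> q"
  define \<tau> :: "nat \<Rightarrow> real" where "\<tau> k = (1 + (1/2) ^ k)\<^sup>2" for k
  have \<tau>0: "0 < \<tau> k" for k
  proof -
    have "0 < 1 + (1/2 :: real) ^ k" by (intro add_pos_pos) auto
    then show ?thesis unfolding \<tau>_def by (rule zero_less_power)
  qed
  define A where "A k = {x \<in> space \<mu>. \<tau> k * q x \<le> p x \<and> 0 < p x}" for k
  have A[measurable]: "A k \<in> sets \<mu>" for k unfolding A_def by measurable
  have A_eq: "{x \<in> space \<mu>. ennreal (p x) / ennreal (q x) \<ge> ennreal (\<tau> k)} = A k" for k
  proof -
    have "ennreal (\<tau> k) \<le> ennreal (p x) / ennreal (q x) \<longleftrightarrow> \<tau> k * q x \<le> p x \<and> 0 < p x"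
      if x: "x \<in> space \<mu>" for x
    proof (cases "q x = 0")
      case True
      then show ?thesis using p0[OF x] \<tau>0[of k]
        by (cases "p x = 0") (auto simp: ennreal_divide_zero less_le)
    next
      case False
      then have "0 < q x" using q0[OF x] by simp
      moreover from this have "0 < p x" if "\<tau> k * q x \<le> p x"
        using that mult_pos_pos[OF \<tau>0[of k]] by (meson less_le_trans)
      ultimately show ?thesis using p0[OF x]
        by (auto simp: divide_ennreal pos_le_divide_eq)
    qed
    then show ?thesis by (auto simp: A_def)
  qed
  have Dk: "1 / 2 * (sqrt (measure ?P (A k)) - sqrt (measure ?Q (A k)))\<^sup>2 \<le> D" for k
    using D[of "\<tau> k"] unfolding A_eq .
  note ip = prob_density_integrable[OF p] and iq = prob_density_integrable[OF q]
  have iA: "integrable \<mu> (\<lambda>x. indicator (A k) x * f x)" if "integrable \<mu> f" for f :: "_ \<Rightarrow> real" and k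
    by (rule integrable_mult_indicator[OF A that, unfolded real_scaleR_def])
  note mP = measure_distribution_of[OF p A] and mQ = measure_distribution_of[OF q A]
  \<comment> \<open>Integrating the pointwise bound over \<open>A k\<close> carries the relative
    excess \<open>(1/2) ^ k\<close> from root densities to root probabilities. Its square is the
    weight of the layer up to the factor 4, so every layer costs the same \<open>8 * D\<close>; this
    is the source of the factor \<open>K + 1\<close>.\<close>
  have ratio: "(1 + (1/2) ^ k) * sqrt (measure ?Q (A k)) \<le> sqrt (measure ?P (A k))" for k
  proof -
    have "\<tau> k * measure ?Q (A k) = (\<integral>x. \<tau> k * (indicator (A k) x * q x) \<partial>\<mu>)"
      unfolding mQ by simp
    also have "\<dots> \<le> (\<integral>x. indicator (A k) x * p x \<partial>\<mu>)"
      using iA[OF ip(1), of k] iA[OF iq(1), of k]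
      by (intro integral_mono) (auto simp: A_def indicator_def)
    also have "\<dots> = measure ?P (A k)" by (simp add: mP)
    finally have "sqrt (\<tau> k * measure ?Q (A k)) \<le> sqrt (measure ?P (A k))" by simp
    then show ?thesis by (simp add: \<tau>_def real_sqrt_mult add_nonneg_nonneg)
  qed
  \<comment> \<open>On the top layer the ratio is unbounded, so mass under \<open>p\<close> has to
    be controlled. There one root probability is at least twice the other, and the difference is at
    least half of the larger.\<close>
  have top: "measure ?P (A 0) \<le> 8 * D"
  proof -
    have "sqrt (measure ?P (A 0)) / 2 \<le> sqrt (measure ?P (A 0)) - sqrt (measure ?Q (A 0))"
      using ratio[of 0] by simp
    then have "(sqrt (measure ?P (A 0)) / 2)\<^sup>2
        \<le> (sqrt (measure ?P (A 0)) - sqrt (measure ?Q (A 0)))\<^sup>2"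
      by (intro power_mono) auto
    then show ?thesis using Dk[of 0] by (simp add: power_divide)
  qed
  have layer: "4 * (1/4) ^ k * measure ?Q (A k) \<le> 8 * D" for k
  proof -
    have "(1/2) ^ k * sqrt (measure ?Q (A k)) \<le> sqrt (measure ?P (A k)) - sqrt (measure ?Q (A k))"
      using ratio[of k] by (simp add: algebra_simps)
    then have "((1/2) ^ k * sqrt (measure ?Q (A k)))\<^sup>2
        \<le> (sqrt (measure ?P (A k)) - sqrt (measure ?Q (A k)))\<^sup>2"
      by (intro power_mono) auto
    moreover have "((1/2) ^ k * sqrt (measure ?Q (A k)))\<^sup>2 = (1/4) ^ k * measure ?Q (A k)"
      by (simp add: power_mult_distrib power_mult[symmetric] mult.commute[of k])
        (simp add: power_mult power2_eq_square)
    ultimately show ?thesis using Dk[of k] by linarith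
  qed
  let ?L = "\<lambda>x. (if q x \<le> p x then (sqrt (p x) - sqrt (q x))\<^sup>2 else 0)"
  show iL: "integrable \<mu> ?L"
    using integrable_sqrt_diff_sq(1)[OF p q]
  proof (rule Bochner_Integration.integrable_bound)
    show "AE x in \<mu>. norm (?L x) \<le> norm ((sqrt (p x) - sqrt (q x))\<^sup>2)" by (intro AE_I2) simp
  qed measurable
  let ?U = "\<lambda>x. indicator (A 0) x * p x + (\<Sum>k=1..K. 4 * (1/4) ^ k * (indicator (A k) x * q x)) + (1/4) ^ K * q x"
  have iU: "integrable \<mu> ?U"
    by (intro Bochner_Integration.integrable_add Bochner_Integration.integrable_sum
        iA ip(1) iq(1) Bochner_Integration.integrable_mult_right)
  have "(\<integral>x. ?L x \<partial>\<mu>) \<le> (\<integral>x. ?U x \<partial>\<mu>)"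
  proof (rule integral_mono[OF iL iU])
    fix x assume x: "x \<in> space \<mu>"
    show "?L x \<le> ?U x"
    proof (cases "q x \<le> p x")
      case True
      have ind: "of_bool ((1 + (1/2) ^ k)\<^sup>2 * q x \<le> p x \<and> 0 < p x) = (indicator (A k) x :: real)" for k
        using x by (simp add: A_def \<tau>_def indicator_def)
      show ?thesis
        using sqrt_diff_sq_le_layers[OF p0[OF x] q0[OF x] True, of K] True unfolding ind by simp
    next
      case False
      then show ?thesis using p0[OF x] q0[OF x] by (auto intro!: add_nonneg_nonneg sum_nonneg)
    qed
  qed
  also have "\<dots> = measure ?P (A 0) + (\<Sum>k=1..K. 4 * (1/4) ^ k * measure ?Q (A k)) + (1/4) ^ K"
    using iA[OF ip(1)] iA[OF iq(1)] iq
    by (simp add: mP mQ Bochner_Integration.integral_add Bochner_Integration.integral_sum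
        Bochner_Integration.integrable_sum)
  also have "\<dots> \<le> 8 * D + (\<Sum>k=1..K. 8 * D) + (1/4) ^ K"
    by (intro add_mono sum_mono top layer order_refl)
  also have "\<dots> = 8 * D * (K + 1) + (1/4) ^ K" by (simp add: algebra_simps)
  finally show "(\<integral>x. ?L x \<partial>\<mu>) \<le> 8 * D * (K + 1) + (1/4) ^ K" .
qed

text \<open>\<open>ratio_class\<close> contains both orders of a pair, so the one-sided bound serves
  for \<open>p\<close> over \<open>q\<close> and for \<open>q\<close> over \<open>p\<close>. The
  factor 1/2 in the Hellinger distance absorbs the sum of the two.\<close>

lemma hellinger_sq_le_class_dist:
  fixes K :: nat
  assumes F: "\<forall>g\<in>F. prob_density \<mu> g" and p: "p \<in> F" and q: "q \<in> F"
    and D: "\<And>H. H \<in> ratio_class \<mu> F \<Longrightarrow>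
      1 / 2 * (sqrt (measure (distribution_of \<mu> p) H) - sqrt (measure (distribution_of \<mu> q) H))\<^sup>2 \<le> D"
  shows "hellinger_sq (distribution_of \<mu> p) (distribution_of \<mu> q) \<le> 8 * D * (K + 1) + (1/4) ^ K"
proof -
  have pd: "prob_density \<mu> p" and qd: "prob_density \<mu> q" using F p q by auto
  have D1: "1 / 2 * (sqrt (measure (distribution_of \<mu> p) H) - sqrt (measure (distribution_of \<mu> q) H))\<^sup>2 \<le> D"
    if "H = {x \<in> space \<mu>. ennreal (p x) / ennreal (q x) \<ge> ennreal \<tau>}" for H and \<tau> :: real
    using p q that by (intro D) (auto simp: ratio_class_def)
  have D2: "1 / 2 * (sqrt (measure (distribution_of \<mu> q) H) - sqrt (measure (distribution_of \<mu> p) H))\<^sup>2 \<le> D"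
    if "H = {x \<in> space \<mu>. ennreal (q x) / ennreal (p x) \<ge> ennreal \<tau>}" for H and \<tau> :: real
    using p q that by (subst power2_commute, intro D) (auto simp: ratio_class_def)
  note pq = one_sided_hellinger_le[OF pd qd D1[OF refl]]
  note qp = one_sided_hellinger_le[OF qd pd D2[OF refl]]
  have "(\<integral>x. (sqrt (p x) - sqrt (q x))\<^sup>2 \<partial>\<mu>)
      \<le> (\<integral>x. (if q x \<le> p x then (sqrt (p x) - sqrt (q x))\<^sup>2 else 0)
            + (if p x \<le> q x then (sqrt (q x) - sqrt (p x))\<^sup>2 else 0) \<partial>\<mu>)"
    by (rule integral_mono[OF integrable_sqrt_diff_sq(1)[OF pd qd]
          Bochner_Integration.integrable_add[OF pq(2) qp(2)]])
      (auto simp: power2_commute)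
  also have "\<dots> \<le> (8 * D * (K + 1) + (1/4) ^ K) + (8 * D * (K + 1) + (1/4) ^ K)"
    unfolding Bochner_Integration.integral_add[OF pq(2) qp(2)] by (intro add_mono pq(1) qp(1))
  finally show ?thesis using hellinger_density[OF pd qd] by simp
qed

subsection \<open>The minimum-distance estimator\<close>

lemma optimize_truncation_level:
  fixes h \<epsilon> X :: real and n :: nat
  assumes h: "0 \<le> h" "h \<le> 1" and n: "2 \<le> n" and \<epsilon>: "1 / n \<le> \<epsilon>"
    and X: "\<And>K::nat. X \<le> 2 * h + 2 * (64 * (h + 12 * \<epsilon>) * (K + 1) + (1/4) ^ K)"
  shows "X \<le> 4000 * (h * log 2 (2 / h) + \<epsilon> * log 2 n)"
proof -
  \<comment> \<open>With \<open>2 ^ K\<close> of order \<open>1 / m\<close> the remainder is at most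
    \<open>2 * (h + \<epsilon>)\<close>, while \<open>K\<close> stays below \<open>log 2 n\<close>
    and, for positive \<open>h\<close>, below \<open>log 2 (1 / h)\<close>. The maximum with
    \<open>1 / n\<close> keeps the level finite at \<open>h = 0\<close>.\<close>
  define m where "m = max h (1 / n)"
  have n0: "0 < 1 / real n" using n by simp
  then have m: "0 < m" "m \<le> 1" "1 / n \<le> m" "h \<le> m"
    using h n by (auto simp: m_def less_max_iff_disj)
  have \<epsilon>0: "0 < \<epsilon>" using \<epsilon> n0 by linarith
  have logn: "1 \<le> log 2 n" using n by (subst le_log_iff) auto
  define K where "K = nat \<lfloor>log 2 (1 / m)\<rfloor>"
  have l0: "0 \<le> log 2 (1 / m)" using m by (simp add: zero_le_log_cancel_iff)
  then have Kr: "real K = of_int \<lfloor>log 2 (1 / m)\<rfloor>" by (simp add: K_def)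
  have K1: "K \<le> log 2 (1 / m)" unfolding Kr by simp
  have "log 2 (1 / m) < real K + 1" unfolding Kr by linarith
  then have "1 / m < 2 powr (real K + 1)" using m by (subst (asm) log_less_iff) auto
  then have "1 / m < 2 * 2 ^ K" by (simp add: powr_add powr_realpow)
  then have "(1/2) ^ K < 2 * m" using m by (simp add: field_simps power_divide)
  moreover have "(1/4 :: real) ^ K \<le> (1/2) ^ K" by (intro power_mono) auto
  ultimately have K2: "(1/4) ^ K \<le> 2 * (h + \<epsilon>)" using h \<epsilon> \<epsilon>0 by (auto simp: m_def max_def split: if_splits)
  \<comment> \<open>The extra level turns \<open>1 / h\<close> into \<open>2 / h\<close> inside the
    logarithm. At \<open>h = 0\<close> both sides are 0, in agreement with the reading of x log (c /
    x) at 0.\<close>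
  have hL: "h * (K + 1) \<le> h * log 2 (2 / h)"
  proof (cases "h = 0")
    case False
    then have h0: "0 < h" using h by simp
    have "K + 1 \<le> log 2 (1 / m) + 1" using K1 by simp
    also have "\<dots> \<le> log 2 (1 / h) + 1" using m h0 by (auto intro!: frac_le)
    also have "\<dots> = log 2 (2 / h)" using h0 by (simp add: log_divide)
    finally show ?thesis using h by (intro mult_left_mono) auto
  qed simp
  have "h * 1 \<le> h * (K + 1)" using h by (intro mult_left_mono) auto
  then have hh: "h \<le> h * log 2 (2 / h)" using hL by simp
  have "K \<le> log 2 n"
  proof -
    have "1 / m \<le> n" using m n by (simp add: field_simps)
    then have "log 2 (1 / m) \<le> log 2 n" using m n by (subst log_le_cancel_iff) auto
    then show ?thesis using K1 by linarith
  qed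
  then have "K + 1 \<le> 2 * log 2 n" using logn by linarith
  then have "\<epsilon> * (K + 1) \<le> \<epsilon> * (2 * log 2 n)" using \<epsilon>0 by (intro mult_left_mono) auto
  then have eL: "\<epsilon> * (K + 1) \<le> 2 * (\<epsilon> * log 2 n)" by (simp only: mult.left_commute)
  have ee: "\<epsilon> \<le> \<epsilon> * log 2 n" using \<epsilon>0 logn by simp
  have "X \<le> 2 * h + 2 * (64 * (h + 12 * \<epsilon>) * (K + 1) + (1/4) ^ K)" by (rule X)
  also have "\<dots> = 2 * h + 128 * (h * (K + 1)) + 1536 * (\<epsilon> * (K + 1)) + 2 * (1/4) ^ K"
    by (simp add: algebra_simps)
  also have "\<dots> \<le> 2 * h + 128 * (h * log 2 (2 / h)) + 1536 * (2 * (\<epsilon> * log 2 n)) + 4 * (h + \<epsilon>)"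
    using hL eL K2 by linarith
  \<comment> \<open>Since \<open>h\<close> and \<open>\<epsilon>\<close> are dominated by their
    logarithmic terms, the coefficients add up to 134 and 3076; 4000 is a round number above
    both.\<close>
  also have "\<dots> \<le> 4000 * (h * log 2 (2 / h)) + 4000 * (\<epsilon> * log 2 n)"
  proof -
    have "2 * h + 128 * L + 1536 * (2 * M) + 4 * (h + \<epsilon>) \<le> 4000 * L + 4000 * M"
      if "h \<le> L" "\<epsilon> \<le> M" for L M
      using that h \<epsilon>0 by simp
    from this[OF hh ee] show ?thesis .
  qed
  finally show ?thesis unfolding distrib_left .
qed

text \<open>For \<open>n \<ge> 2\<close> one has \<open>2 * n + 1 \<le> n ^ 3\<close>, so the factor
  3 in the exponent is what cancels the number of patterns. What remains is at most
  \<open>4 * (\<delta> / 2) ^ 3\<close>, hence below \<open>\<delta>\<close>. Base 2 logarithms only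
  make the exponential smaller than natural ones would.\<close>

lemma deviation_failure_le:
  fixes \<delta> :: real and n d :: nat
  assumes n: "2 \<le> n" and \<delta>: "0 < \<delta>" "\<delta> < 1"
  shows "4 * (2 * real n + 1) ^ d * exp (- (3 * (d * log 2 n + log 2 (2 / \<delta>)))) \<le> \<delta>"
proof -
  have ln_le_log: "ln x \<le> log 2 x" if "1 \<le> x" for x :: real
  proof -
    have "ln 2 \<le> (1::real)" using ln_le_minus_one[of 2] by simp
    then show ?thesis using that unfolding log_def
      by (simp add: pos_le_divide_eq mult_left_le)
  qed
  have "2 * real n + 1 \<le> real n ^ 3"
  proof -
    have "2 * n + 1 \<le> 4 * n" using n by simp
    also have "\<dots> \<le> n * n * n" using mult_le_mono[OF n n] by simp
    finally have "2 * n + 1 \<le> n ^ 3" by (simp add: power3_eq_cube)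
    then have "real (2 * n + 1) \<le> real (n ^ 3)" by (rule of_nat_mono)
    then show ?thesis by simp
  qed
  then have 1: "(2 * real n + 1) ^ d \<le> (real n ^ 3) ^ d" by (intro power_mono) auto
  have "d * ln n + ln (2 / \<delta>) \<le> d * log 2 n + log 2 (2 / \<delta>)"
    using n \<delta> by (intro add_mono mult_left_mono ln_le_log) auto
  then have "exp (- (3 * (d * log 2 n + log 2 (2 / \<delta>)))) \<le> exp (- (3 * (d * ln n + ln (2 / \<delta>))))"
    by simp
  also have "\<dots> = inverse ((exp (d * ln n) * exp (ln (2 / \<delta>))) ^ 3)"
    unfolding exp_add[symmetric] using exp_of_nat_mult[of 3 "d * ln n + ln (2 / \<delta>)"]
    by (simp only: exp_minus of_nat_numeral)
  also have "exp (d * ln n) = real n ^ d" using n by (simp add: exp_of_nat_mult)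
  also have "exp (ln (2 / \<delta>)) = 2 / \<delta>" using \<delta> by simp
  also have "inverse ((real n ^ d * (2 / \<delta>)) ^ 3) = inverse ((real n ^ 3) ^ d) * (\<delta> / 2) ^ 3"
    by (simp add: power_mult_distrib power_divide power_mult[symmetric] mult.commute)
      (simp add: divide_inverse mult.commute)
  finally have 2: "exp (- (3 * (d * log 2 n + log 2 (2 / \<delta>)))) \<le> inverse ((real n ^ 3) ^ d) * (\<delta> / 2) ^ 3" .
  have "(2 * real n + 1) ^ d * exp (- (3 * (d * log 2 n + log 2 (2 / \<delta>))))
      \<le> (real n ^ 3) ^ d * (inverse ((real n ^ 3) ^ d) * (\<delta> / 2) ^ 3)"
    by (rule mult_mono[OF 1 2]) auto
  also have "\<dots> = (\<delta> / 2) ^ 3" using n by simp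
  finally have "4 * ((2 * real n + 1) ^ d * exp (- (3 * (d * log 2 n + log 2 (2 / \<delta>))))) \<le> 4 * (\<delta> / 2) ^ 3"
    by simp
  also have "\<dots> = \<delta> * (\<delta> * \<delta>) / 2" by (simp add: power3_eq_cube)
  also have "\<dots> \<le> \<delta> * 1 / 2" using \<delta> by (intro divide_right_mono mult_left_mono mult_le_one) auto
  also have "\<dots> \<le> \<delta>" using \<delta> by simp
  finally show ?thesis by (simp add: mult.assoc)
qed

section \<open>Measurability of threshold sets and the empirical distribution\<close>

lemma sets_ratio_class:
  assumes F: "\<forall>g\<in>F. prob_density \<mu> g" and H: "H \<in> ratio_class \<mu> F"
  shows "H \<in> sets \<mu>"
proof -
  obtain f g and \<tau> :: real where fg: "f \<in> F" "g \<in> F"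
    and H_eq: "H = {x \<in> space \<mu>. ennreal (f x) / ennreal (g x) \<ge> ennreal \<tau>}"
    using H unfolding ratio_class_def by blast
  have [measurable]: "f \<in> borel_measurable \<mu>" "g \<in> borel_measurable \<mu>"
    using F fg by (auto simp: prob_density_def)
  show ?thesis unfolding H_eq by measurable
qed

lemma measure_empirical:
  assumes \<omega>: "\<And>i. i < n \<Longrightarrow> \<omega> i \<in> space M" and A: "A \<in> sets M"
  shows "measure (empirical n M \<omega>) A = card {i \<in> {..<n}. \<omega> i \<in> A} / n"
proof -
  have "\<omega> \<in> uniform_count_measure {..<n} \<rightarrow>\<^sub>M M"
    using \<omega> sets.sets_into_space by (auto simp: measurable_def sets_uniform_count_measure space_uniform_count_measure)
  then have "measure (empirical n M \<omega>) A
      = measure (uniform_count_measure {..<n}) (\<omega> -` A \<inter> space (uniform_count_measure {..<n}))"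
    unfolding empirical_def using A by (rule measure_distr)
  also have "\<omega> -` A \<inter> space (uniform_count_measure {..<n}) = {i \<in> {..<n}. \<omega> i \<in> A}"
    by (auto simp: space_uniform_count_measure)
  also have "measure (uniform_count_measure {..<n}) \<dots> = card {i \<in> {..<n}. \<omega> i \<in> A} / n"
    by (subst measure_uniform_count_measure) auto
  finally show ?thesis .
qed

lemma prob_space_empirical:
  assumes "\<And>i. i < n \<Longrightarrow> \<omega> i \<in> space M" "0 < n"
  shows "prob_space (empirical n M \<omega>)"
  unfolding empirical_def
proof (rule prob_space.prob_space_distr)
  show "prob_space (uniform_count_measure {..<n})"
    using assms by (intro prob_space_uniform_count_measure) auto
  show "\<omega> \<in> uniform_count_measure {..<n} \<rightarrow>\<^sub>M M"
    using assms by (auto simp: measurable_def sets_uniform_count_measure space_uniform_count_measure)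
qed

text \<open>A real supremum dominates its members only when the family is bounded above; for
  probability measures 1 is a bound.\<close>

lemma class_dist_upper:
  assumes p: "prob_space p" and q: "prob_space q" and H: "H \<in> \<H>"
  shows "1 / 2 * (sqrt (measure p H) - sqrt (measure q H))\<^sup>2 \<le> class_dist \<H> p q"
  unfolding class_dist_def
proof (rule cSUP_upper[OF H])
  have "1 / 2 * (sqrt (measure p H) - sqrt (measure q H))\<^sup>2 \<le> 1" for H
  proof -
    have "sqrt (measure p H) \<le> 1" "sqrt (measure q H) \<le> 1"
      using prob_space.prob_le_1[OF p, of H] prob_space.prob_le_1[OF q, of H] by auto
    moreover have "0 \<le> sqrt (measure p H)" "0 \<le> sqrt (measure q H)" by simp_all
    ultimately have "\<bar>sqrt (measure p H) - sqrt (measure q H)\<bar> \<le> 1" by linarith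
    then have "(sqrt (measure p H) - sqrt (measure q H))\<^sup>2 \<le> 1" by (simp add: abs_square_le_1)
    then show ?thesis by simp
  qed
  then show "bdd_above ((\<lambda>H. 1 / 2 * (sqrt (measure p H) - sqrt (measure q H))\<^sup>2) ` \<H>)"
    by (intro bdd_aboveI2[where M = 1])
qed

text \<open>Origin of the 64: \<open>g\<close> is within \<open>2 * h + 2 * c\<close> of
  \<open>N\<close> in class distance, and so is \<open>fhat\<close> by minimality. Another doubled
  triangle inequality puts them within \<open>8 * h + 8 * c\<close> of each other, and the dyadic
  bound multiplies by 8.\<close>

lemma minimum_distance_bound:
  fixes c :: real
  assumes F: "\<forall>g\<in>F. prob_density \<mu> g" and P: "prob_space P" and sets: "sets P = sets \<mu>"
    and N: "prob_space N" and \<H>: "\<H> = ratio_class \<mu> F"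
    and dev: "\<And>H. H \<in> \<H> \<Longrightarrow> 1 / 2 * (sqrt (measure P H) - sqrt (measure N H))\<^sup>2 \<le> c"
    and fhat: "is_arg_min (\<lambda>g. class_dist \<H> (distribution_of \<mu> g) N) (\<lambda>g. g \<in> F) fhat"
    and g: "g \<in> F"
  defines "h \<equiv> hellinger_sq P (distribution_of \<mu> g)"
  shows "hellinger_sq P (distribution_of \<mu> fhat) \<le> 2 * h + 2 * (64 * (h + c) * (real K + 1) + (1/4) ^ K)"
proof -
  let ?d = "distribution_of \<mu>"
  have fF: "fhat \<in> F" and min: "class_dist \<H> (?d fhat) N \<le> class_dist \<H> (?d g) N"
    using fhat g by (auto simp: is_arg_min_linorder)
  have pf: "prob_space (?d fhat)" and pg: "prob_space (?d g)"
    using F fF g by (auto intro: prob_space_distribution_of)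
  have "\<H> \<noteq> {}" using g by (auto simp: \<H> ratio_class_def)
  then have gN: "class_dist \<H> (?d g) N \<le> 2 * h + 2 * c"
    unfolding class_dist_def
  proof (rule cSUP_least)
    fix H assume H: "H \<in> \<H>"
    have "1 / 2 * (sqrt (measure P H) - sqrt (measure (?d g) H))\<^sup>2 \<le> h"
      unfolding h_def using H sets_ratio_class[OF F] sets
      by (intro sqrt_prob_diff_le_hellinger_sq P pg) (auto simp: \<H>)
    then show "1 / 2 * (sqrt (measure (?d g) H) - sqrt (measure N H))\<^sup>2 \<le> 2 * h + 2 * c"
      using half_sq_triangle[of "sqrt (measure (?d g) H)" "sqrt (measure N H)" "sqrt (measure P H)"]
        dev[OF H] by (simp only: power2_commute[of "sqrt (measure (?d g) H)"])
  qed
  have "hellinger_sq (?d g) (?d fhat) \<le> 8 * (8 * h + 8 * c) * (K + 1) + (1/4) ^ K"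
  proof (rule hellinger_sq_le_class_dist[OF F g fF])
    fix H assume H: "H \<in> ratio_class \<mu> F"
    then have H': "H \<in> \<H>" by (simp add: \<H>)
    have "1 / 2 * (sqrt (measure (?d g) H) - sqrt (measure (?d fhat) H))\<^sup>2
        \<le> 2 * (1 / 2 * (sqrt (measure (?d g) H) - sqrt (measure N H))\<^sup>2)
         + 2 * (1 / 2 * (sqrt (measure (?d fhat) H) - sqrt (measure N H))\<^sup>2)"
      using half_sq_triangle[of "sqrt (measure (?d g) H)" "sqrt (measure (?d fhat) H)" "sqrt (measure N H)"]
      by (simp only: power2_commute[of "sqrt (measure N H)"])
    also have "\<dots> \<le> 2 * class_dist \<H> (?d g) N + 2 * class_dist \<H> (?d fhat) N"
      by (intro add_mono mult_left_mono class_dist_upper pf pg N H') auto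
    also have "\<dots> \<le> 8 * h + 8 * c" using min gN by linarith
    finally show "1 / 2 * (sqrt (measure (?d g) H) - sqrt (measure (?d fhat) H))\<^sup>2 \<le> 8 * h + 8 * c" .
  qed
  moreover have "hellinger_sq P (?d fhat) \<le> 2 * h + 2 * hellinger_sq (?d g) (?d fhat)"
    unfolding h_def using sets by (intro hellinger_sq_triangle P pg pf) auto
  ultimately show ?thesis by (simp add: algebra_simps)
qed

theorem theorem7:
  shows "\<exists>C>0. \<forall>(\<mu> :: 'a measure) (F :: ('a \<Rightarrow> real) set) (P :: 'a measure) (d :: nat) (n :: nat)
            (\<delta> :: real) (fhat :: (nat \<Rightarrow> 'a) \<Rightarrow> ('a \<Rightarrow> real)).
     (\<forall>g\<in>F. prob_density \<mu> g) \<longrightarrow>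
     vc_dim (ratio_class \<mu> F) = enat d \<longrightarrow> 1 \<le> d \<longrightarrow>
     2 \<le> n \<longrightarrow> 0 < \<delta> \<longrightarrow> \<delta> < 1 \<longrightarrow>
     prob_space P \<longrightarrow> sets P = sets \<mu> \<longrightarrow> no_atoms P \<longrightarrow>
     sample_measurable P (ratio_class \<mu> F) \<longrightarrow>
     (\<forall>\<omega>\<in>space (iid_sample n P).
        is_arg_min (\<lambda>g. class_dist (ratio_class \<mu> F) (distribution_of \<mu> g) (empirical n \<mu> \<omega>))
          (\<lambda>g. g \<in> F) (fhat \<omega>)) \<longrightarrow>
     (\<exists>E\<in>sets (iid_sample n P). measure (iid_sample n P) E \<ge> 1 - \<delta> \<and>
        (\<forall>\<omega>\<in>E.
           hellinger_sq P (distribution_of \<mu> (fhat \<omega>))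
             \<le> C * ((INF g\<in>F. hellinger_sq P (distribution_of \<mu> g)
                               * log 2 (2 / hellinger_sq P (distribution_of \<mu> g)))
                    + (real d * log 2 (real n) + log 2 (2 / \<delta>)) * log 2 (real n) / real n)))"
proof (intro exI[of _ 4000] conjI allI impI)
  fix \<mu> :: "'a measure" and F :: "('a \<Rightarrow> real) set" and P :: "'a measure" and d n :: nat
    and \<delta> :: real and fhat :: "(nat \<Rightarrow> 'a) \<Rightarrow> ('a \<Rightarrow> real)"
  let ?H = "ratio_class \<mu> F"
  assume F: "\<forall>g\<in>F. prob_density \<mu> g" and vc: "vc_dim ?H = enat d" and d: "1 \<le> d"
    and n: "2 \<le> n" and \<delta>: "0 < \<delta>" "\<delta> < 1" and P: "prob_space P" and sets: "sets P = sets \<mu>"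
    and sm: "sample_measurable P ?H"
    and fhat: "\<forall>\<omega>\<in>space (iid_sample n P).
        is_arg_min (\<lambda>g. class_dist ?H (distribution_of \<mu> g) (empirical n \<mu> \<omega>))
          (\<lambda>g. g \<in> F) (fhat \<omega>)"
  define \<epsilon> where "\<epsilon> = (real d * log 2 (real n) + log 2 (2 / \<delta>)) / n"
  have "1 \<le> log 2 n" using n by (subst le_log_iff) auto
  moreover have "1 \<le> real d" using d by simp
  ultimately have "1 * 1 \<le> real d * log 2 n" by (intro mult_mono) auto
  moreover have "0 \<le> log 2 (2 / \<delta>)" using \<delta> by (subst zero_le_log_cancel_iff) auto
  \<comment> \<open>This uses \<open>d \<ge> 1\<close> and \<open>n \<ge> 2\<close>. It supplies the
    Chebyshev condition \<open>2 \<le> n * s\<^sup>2\<close> and lets \<open>\<epsilon>\<close>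
    absorb the \<open>1 / n\<close> in the choice of the truncation level.\<close>
  ultimately have n\<epsilon>: "1 \<le> n * \<epsilon>" using n by (simp add: \<epsilon>_def)
  then have \<epsilon>: "1 / n \<le> \<epsilon>" using n by (simp add: field_simps)
  moreover have "0 < 1 / real n" using n by simp
  ultimately have \<epsilon>0: "0 < \<epsilon>" by linarith
  \<comment> \<open>The 6 makes \<open>n * s\<^sup>2 / 2\<close> equal to
    \<open>3 * n * \<epsilon>\<close>, the exponent in \<open>deviation_failure_le\<close>. A root
    deviation of \<open>2 * s\<close> then becomes a halved square of
    \<open>12 * \<epsilon>\<close>.\<close>
  define s where "s = sqrt (6 * \<epsilon>)"
  have s: "0 < s" "s\<^sup>2 = 6 * \<epsilon>" using \<epsilon>0 by (simp_all add: s_def)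
  have "2 \<le> n * s\<^sup>2" unfolding s(2) using n\<epsilon> by linarith
  then have "\<exists>E\<in>sets (iid_sample n P).
     1 - 4 * (2 * real n + 1) ^ d * exp (- (n * s\<^sup>2 / 2)) \<le> measure (iid_sample n P) E \<and>
     (\<forall>\<omega>\<in>E. \<forall>H\<in>?H. \<bar>sqrt (measure P H) - sqrt (card {i \<in> {..<n}. \<omega> i \<in> H} / n)\<bar> \<le> 2 * s)"
    using sets_ratio_class[OF F] sets s n by (intro uniform_sqrt_deviation P vc sm) simp_all
  then obtain E where E: "E \<in> sets (iid_sample n P)"
    and PE_dev: "1 - 4 * (2 * real n + 1) ^ d * exp (- (n * s\<^sup>2 / 2)) \<le> measure (iid_sample n P) E \<and>
     (\<forall>\<omega>\<in>E. \<forall>H\<in>?H. \<bar>sqrt (measure P H) - sqrt (card {i \<in> {..<n}. \<omega> i \<in> H} / n)\<bar> \<le> 2 * s)"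
    by (rule bexE)
  note PE = conjunct1[OF PE_dev] and dev = conjunct2[OF PE_dev]
  have exponent: "n * s\<^sup>2 / 2 = 3 * (d * log 2 n + log 2 (2 / \<delta>))" using n by (simp add: s(2) \<epsilon>_def)
  have prob: "1 - \<delta> \<le> measure (iid_sample n P) E"
    using PE[unfolded exponent] deviation_failure_le[OF n \<delta>, of d] by linarith
  have bound: "hellinger_sq P (distribution_of \<mu> (fhat \<omega>))
      \<le> 4000 * ((INF g\<in>F. hellinger_sq P (distribution_of \<mu> g)
                               * log 2 (2 / hellinger_sq P (distribution_of \<mu> g)))
                    + (real d * log 2 (real n) + log 2 (2 / \<delta>)) * log 2 (real n) / real n)"
    (is "?X \<le> 4000 * ((INF g\<in>F. ?L g) + ?R)")
    if \<omega>: "\<omega> \<in> E" for \<omega>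
  proof -
    have \<omega>s: "\<omega> \<in> space (iid_sample n P)" using sets.sets_into_space[OF E] \<omega> by (rule subsetD)
    then have \<omega>i: "\<omega> i \<in> space \<mu>" if "i < n" for i
      using that sets_eq_imp_space_eq[OF sets] by (auto simp: iid_sample_def space_PiM PiE_def)
    have N: "prob_space (empirical n \<mu> \<omega>)" using \<omega>i n by (intro prob_space_empirical) auto
    have argmin: "is_arg_min (\<lambda>g. class_dist ?H (distribution_of \<mu> g) (empirical n \<mu> \<omega>)) (\<lambda>g. g \<in> F) (fhat \<omega>)"
      using fhat \<omega>s by blast
    \<comment> \<open>The greatest-lower-bound rule for a real infimum needs a nonempty index set;
      the minimizer at \<open>\<omega>\<close> provides an element.\<close>
    then have "F \<noteq> {}" by (auto simp: is_arg_min_def)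
    have devN: "1 / 2 * (sqrt (measure P H) - sqrt (measure (empirical n \<mu> \<omega>) H))\<^sup>2 \<le> 12 * \<epsilon>"
      if H: "H \<in> ?H" for H
    proof -
      have "\<bar>sqrt (measure P H) - sqrt (measure (empirical n \<mu> \<omega>) H)\<bar> \<le> 2 * s"
        using dev \<omega> H \<omega>i sets_ratio_class[OF F H] by (simp add: measure_empirical)
      then have "\<bar>sqrt (measure P H) - sqrt (measure (empirical n \<mu> \<omega>) H)\<bar>\<^sup>2 \<le> (2 * s)\<^sup>2"
        by (intro power_mono) auto
      then show ?thesis using s(2) by (simp add: power_mult_distrib)
    qed
    have main: "?X \<le> 4000 * (?L g + \<epsilon> * log 2 n)" if g: "g \<in> F" for g
    proof (rule optimize_truncation_level[OF _ _ n \<epsilon>])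
      have pg: "prob_space (distribution_of \<mu> g)" using F g by (auto intro: prob_space_distribution_of)
      show "0 \<le> hellinger_sq P (distribution_of \<mu> g)" by (rule hellinger_sq_nonneg)
      show "hellinger_sq P (distribution_of \<mu> g) \<le> 1"
        using sets by (intro hellinger_sq_le_1 P pg) auto
    qed (use minimum_distance_bound[OF F P sets N refl devN argmin g] in \<open>simp add: add.commute\<close>)
    \<comment> \<open>\<open>E\<close> does not depend on \<open>g\<close>, so the bound holds for
      all competitors on the same event. Isolating the term in \<open>g\<close> exhibits a lower
      bound for the whole family, and the infimum can be taken.\<close>
    have "?X / 4000 - ?R \<le> ?L g" if "g \<in> F" for g
    proof -
      have arith: "x \<le> 4000 * (l + r) \<Longrightarrow> x / 4000 - r \<le> l" for x l r :: real by simp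
      have "\<epsilon> * log 2 n = ?R" by (simp add: \<epsilon>_def)
      from arith[OF main[OF that, unfolded this]] show ?thesis .
    qed
    then have "?X / 4000 - ?R \<le> (INF g\<in>F. ?L g)" using \<open>F \<noteq> {}\<close> by (intro cINF_greatest)
    moreover have arith: "x / 4000 - r \<le> l \<Longrightarrow> x \<le> 4000 * (l + r)" for x l r :: real by simp
    ultimately show ?thesis by (intro arith)
  qed
  show "\<exists>E\<in>sets (iid_sample n P). measure (iid_sample n P) E \<ge> 1 - \<delta> \<and>
        (\<forall>\<omega>\<in>E.
           hellinger_sq P (distribution_of \<mu> (fhat \<omega>))
             \<le> 4000 * ((INF g\<in>F. hellinger_sq P (distribution_of \<mu> g)
                               * log 2 (2 / hellinger_sq P (distribution_of \<mu> g)))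
                    + (real d * log 2 (real n) + log 2 (2 / \<delta>)) * log 2 (real n) / real n))"
    using prob bound E by (intro bexI[of _ E] conjI ballI)
qed simp

end
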